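(* Let $n\ge 2$. 1. The map $\rho_n:[1,\mathrm{ord}(\Omega_n)]\to\mathcal{J}(\mathfrak{u}_n)$, $\lambda\mapsto I_\lambda$, is a bijection onto the set $\mathcal{J}(\mathfrak{u}_n)$ of all nonzero ideals of the Lie algebra $\mathfrak{u}_n$. 2. The Lie algebra $\mathfrak{u}_n$ is a uniserial, Artinian but not Noetherian Lie algebra, and its uniserial dimension is equal to $\mathrm{u.dim}(\mathfrak{u}_n)=\mathrm{ord}(\Omega_n)=\omega^{n-1}+\omega^{n-2}+\cdots+\omega+1$.
   Context: $K$ is a field of characteristic zero, $\mathbb{N}=\{0,1,\ldots\}$, $P_0=K$, $P_i=K[x_1,\ldots,x_i]$, $\partial_i=\partial/\partial x_i$. For $n\ge 2$, $\mathfrak{u}_n=K\partial_1+P_1\partial_2+\cdots+P_{n-1}\partial_n$ is the Lie algebra of triangular polynomial derivations, a Lie subalgebra of $\mathrm{Der}_K(P_n)$. For a well-ordered set $S$ in which every non-empty subset has a least element, $\mathrm{ord}(S)$ denotes its ordinal number (its isomorphism class as an ordered set); $\omega=\mathrm{ord}(\mathbb{N})$ is the first infinite ordinal. $\mathfrak{u}_n$ has the $K$-basis $\mathcal{B}_n=\{X_{\alpha,i}=x^\alpha\partial_i \mid 1\le i\le n,\ \alpha\in\mathbb{N}^{i-1}\}$, where $x^\alpha=x_1^{\alpha_1}\cdots x_{i-1}^{\alpha_{i-1}}$. It is well ordered by: $X_{\alpha,i}>X_{\beta,j}$ iff $i<j$, or $i=j$ and for some $m$ one has $\alpha_m>\beta_m$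 and $\alpha_k=\beta_k$ for all $m<k\le i-1$. Let $\Omega_n$ be the set of indices $(\alpha,i)$ of the basis elements $X_{\alpha,i}$, ordered by $(\alpha,i)\ge(\beta,j)$ iff $X_{\alpha,i}\ge X_{\beta,j}$; then $\mathrm{ord}(\Omega_n)=\mathrm{ord}(\mathcal{B}_n)=\omega^{n-1}+\omega^{n-2}+\cdots+\omega+1$. For $X\in\mathcal{B}_n$ let $\mathrm{ord}(X)$ be the ordinal number of $\{Y\in\mathcal{B}_n\mid Y\le X\}$. Let $[1,\mathrm{ord}(\Omega_n)]$ be the set of ordinals $\lambda$ with $1\le\lambda\le\mathrm{ord}(\Omega_n)$; for such $\lambda$ put $I_\lambda=\bigoplus\{KX\mid X\in\mathcal{B}_n,\ \mathrm{ord}(X)\le\lambda\}$, which is a nonzero ideal of $\mathfrak{u}_n$. For a Lie algebra $\mathcal{G}$, let $\mathcal{J}(\mathcal{G})$ be the set of all nonzero ideals of $\mathcal{G}$, partially ordered by inclusion. $\mathcal{G}$ is Artinian (respectively, Noetherian) if every descending (respectively, ascending) chain of ideals stabilizes; it is uniserial if for any two ideals $\mathfrak{a},\mathfrak{b}$ of $\mathcal{G}$ either $\mathfrak{a}\subseteq\mathfrak{b}$ or $\mathfrak{b}\subseteq\mathfrak{a}$. For an Artinian uniserial Lie algebra $\mathcal{G}$, the uniserial dimension is the ordinal number $\mathrm{u.dim}(\mathcal{G}):=\mathrm{ord}(\mathcal{J}(\mathcal{G}))$ of the Artinian well-ordered set $\mathcal{J}(\mathcal{G})$ of nonzero ideals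 of $\mathcal{G}$.
   Formalization: The printed equation u.dim(u_n) = ord(Ω_n) fails for every n ≥ 2 under the stated definitions (for n = 2 the nonzero ideals have order type ω+2, while ord(Ω_2) = ω+1); the formal statement proves u.dim(u_n) = ord(Ω_n) + 1 instead. *)

theory Defs
  imports
    Complex_Main
    "HOL-Library.Countable_Set"
    "HOL-Library.Function_Algebras"
    "HOL-Library.Poly_Mapping"
begin

unbundle cardinal_syntax

section \<open>Countable ordinals\<close>

text \<open>
  An ordinal is an isomorphism class of well-orders. Working with well-orders on subsets of
  \<^typ>\<open>nat\<close> gives exactly the countable ordinals, which form an initial segment of all
  ordinals. As in \<^theory>\<open>HOL.BNF_Wellorder_Constructions\<close>, well-orders are reflexive
  relations, identified with the order on their field, and \<^const>\<open>ordIso\<close> relates well-orders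
  only.
\<close>

quotient_type ordinal = "nat rel" / partial: "\<lambda>r s. (r, s) \<in> ordIso"
proof (rule part_equivpI)
  show "\<exists>r :: nat rel. r =o r"
    by (rule exI[of _ natLeq], rule ordIso_reflexive, rule natLeq_Well_order)
  show "symp (\<lambda>r s :: nat rel. r =o s)"
    by (rule sympI) (rule ordIso_symmetric)
  show "transp (\<lambda>r s :: nat rel. r =o s)"
    by (rule transpI) (rule ordIso_transitive)
qed

lemma ordIso_Well_orderD: "r =o s \<Longrightarrow> Well_order r \<and> Well_order s"
  by (auto simp: ordIso_def)

instantiation ordinal :: wellorder
begin

lift_definition less_eq_ordinal :: "ordinal \<Rightarrow> ordinal \<Rightarrow> bool" is "\<lambda>r s. (r, s) \<in> ordLeq"
proof -
  fix r s t u :: "nat rel" assume "r =o s" "t =o u"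
  then show "r \<le>o t \<longleftrightarrow> s \<le>o u"
    by (meson ordIso_ordLeq_trans ordLeq_ordIso_trans ordIso_symmetric)
qed

definition less_ordinal :: "ordinal \<Rightarrow> ordinal \<Rightarrow> bool" where
  "less_ordinal x y \<longleftrightarrow> x \<le> y \<and> \<not> y \<le> x"

instance
proof
  fix x y z :: ordinal
  show "x < y \<longleftrightarrow> x \<le> y \<and> \<not> y \<le> x" by (rule less_ordinal_def)
  show "x \<le> x"
    by transfer (simp add: ordIso_iff_ordLeq)
  show "x \<le> z" if "x \<le> y" "y \<le> z"
    using that by transfer (rule ordLeq_transitive)
  show "x = y" if "x \<le> y" "y \<le> x"
    using that by transfer (simp add: ordIso_iff_ordLeq)
  show "x \<le> y \<or> y \<le> x"
    by transfer (simp add: ordLeq_total ordIso_Well_orderD)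
next
  fix P :: "ordinal \<Rightarrow> bool" and a
  assume step: "\<And>x. (\<And>y. y < x \<Longrightarrow> P y) \<Longrightarrow> P x"
  have rep: "rep_ordinal x =o rep_ordinal x" for x
    by (rule Quotient3_rep_reflp[OF Quotient3_ordinal])
  have le: "x \<le> y \<longleftrightarrow> rep_ordinal x \<le>o rep_ordinal y" for x y
    by (simp add: less_eq_ordinal_def)
  have lt: "rep_ordinal x <o rep_ordinal y" if "x < y" for x y
    using that rep[THEN ordIso_Well_orderD]
    by (simp add: less_ordinal_def le not_ordLeq_iff_ordLess)
  have "wf (inv_image ordLess rep_ordinal)"
    by (simp add: wf_ordLess wf_inv_image)
  then show "P a"
    by (induction rule: wf_induct_rule) (use step lt in auto)
qed

end

text \<open>
  The ordinal number of a well-order on an arbitrary type. It is only meaningful for well-orders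
  with countable field.
\<close>

definition ord_of :: "'b rel \<Rightarrow> ordinal" where
  "ord_of r = abs_ordinal (SOME s. r =o s)"

lemma ord_of_iso:
  fixes s :: "nat rel"
  assumes "r =o s"
  shows "ord_of r = abs_ordinal s"
proof -
  have "r =o (SOME s :: nat rel. r =o s)" using assms by (rule someI)
  with assms have "(SOME s :: nat rel. r =o s) =o s"
    by (meson ordIso_symmetric ordIso_transitive)
  then show ?thesis unfolding ord_of_def
    by (rule Quotient3_rel_abs[OF Quotient3_ordinal])
qed

lemma ex_nat_rel:
  assumes "Well_order r" "countable (Field r)"
  obtains s :: "nat rel" where "r =o s"
proof -
  obtain f :: "'a \<Rightarrow> nat" where "inj_on f (Field r)"
    using assms(2) countableE by blast
  then have "r =o dir_image r f" by (rule dir_image_ordIso[OF assms(1)])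
  then show thesis by (rule that)
qed

lemma ord_of_eq_iff:
  assumes "Well_order r" "countable (Field r)" "Well_order s" "countable (Field s)"
  shows "ord_of r = ord_of s \<longleftrightarrow> r =o s"
proof -
  obtain r' :: "nat rel" where r': "r =o r'" using assms(1,2) by (rule ex_nat_rel)
  obtain s' :: "nat rel" where s': "s =o s'" using assms(3,4) by (rule ex_nat_rel)
  have "r' =o r'" "s' =o s'"
    using ordIso_Well_orderD[OF r'] ordIso_Well_orderD[OF s'] by (simp_all add: ordIso_reflexive)
  then have "abs_ordinal r' = abs_ordinal s' \<longleftrightarrow> r' =o s'"
    using Quotient3_rel[OF Quotient3_ordinal, of r' s'] by simp
  also have "\<dots> \<longleftrightarrow> r =o s"
    by (meson r' s' ordIso_symmetric ordIso_transitive)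
  finally show ?thesis using ord_of_iso[OF r'] ord_of_iso[OF s'] by simp
qed


text \<open>
  The ordered sum (first \<open>r\<close>, then \<open>s\<close>) and the ordinal product (\<open>s\<close>-many copies of \<open>r\<close>:
  the second component is the most significant one).
\<close>

definition ordered_sum :: "'b rel \<Rightarrow> 'c rel \<Rightarrow> ('b + 'c) rel" where
  "ordered_sum r s =
     map_prod Inl Inl ` r \<union> map_prod Inr Inr ` s \<union> (Inl ` Field r) \<times> (Inr ` Field s)"

definition ordered_prod :: "'b rel \<Rightarrow> 'c rel \<Rightarrow> ('b \<times> 'c) rel" where
  "ordered_prod r s =
     {((a, c), (b, d)). a \<in> Field r \<and> b \<in> Field r \<and> c \<in> Field s \<and> d \<in> Field s \<and>
        ((c, d) \<in> s \<and> c \<noteq> d \<or> c = d \<and> (a, b) \<in> r)}"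

instantiation ordinal :: "{zero, one, plus, times}"
begin

definition zero_ordinal :: ordinal where
  "0 = ord_of ({} :: nat rel)"

definition one_ordinal :: ordinal where
  "1 = ord_of {((), ())}"

definition plus_ordinal :: "ordinal \<Rightarrow> ordinal \<Rightarrow> ordinal" where
  "x + y = ord_of (ordered_sum (rep_ordinal x) (rep_ordinal y))"

definition times_ordinal :: "ordinal \<Rightarrow> ordinal \<Rightarrow> ordinal" where
  "x * y = ord_of (ordered_prod (rep_ordinal x) (rep_ordinal y))"

instance ..

end

instance ordinal :: power ..

definition omega :: ordinal where
  "omega = ord_of natLeq"

text \<open>\<open>omega_poly n = \<omega>\<^sup>n\<^sup>-\<^sup>1 + \<dots> + \<omega> + 1\<close>, summed in this order.\<close>

primrec omega_poly :: "nat \<Rightarrow> ordinal" where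
  "omega_poly 0 = 0"
| "omega_poly (Suc n) = omega ^ n + omega_poly n"


section \<open>Lie algebras, their ideals, and the uniserial dimension\<close>

locale lie_algebra = vector_space scale
  for scale :: "'k::field \<Rightarrow> 'b::ab_group_add \<Rightarrow> 'b" +
  fixes L :: "'b set" and bracket :: "'b \<Rightarrow> 'b \<Rightarrow> 'b"
  assumes subspace_L: "subspace L"
    and bracket_closed: "\<lbrakk>x \<in> L; y \<in> L\<rbrakk> \<Longrightarrow> bracket x y \<in> L"
    and bracket_add_left: "\<lbrakk>x \<in> L; y \<in> L; z \<in> L\<rbrakk> \<Longrightarrow> bracket (x + y) z = bracket x z + bracket y z"
    and bracket_add_right: "\<lbrakk>x \<in> L; y \<in> L; z \<in> L\<rbrakk> \<Longrightarrow> bracket x (y + z) = bracket x y + bracket x z"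
    and bracket_scale_left: "\<lbrakk>x \<in> L; y \<in> L\<rbrakk> \<Longrightarrow> bracket (scale c x) y = scale c (bracket x y)"
    and bracket_scale_right: "\<lbrakk>x \<in> L; y \<in> L\<rbrakk> \<Longrightarrow> bracket x (scale c y) = scale c (bracket x y)"
    and bracket_self: "x \<in> L \<Longrightarrow> bracket x x = 0"
    and jacobi: "\<lbrakk>x \<in> L; y \<in> L; z \<in> L\<rbrakk> \<Longrightarrow>
      bracket x (bracket y z) + bracket y (bracket z x) + bracket z (bracket x y) = 0"
begin

definition ideal :: "'b set \<Rightarrow> bool" where
  "ideal I \<longleftrightarrow> subspace I \<and> I \<subseteq> L \<and> (\<forall>x\<in>L. \<forall>y\<in>I. bracket x y \<in> I)"

definition nonzero_ideals :: "'b set set" where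
  "nonzero_ideals = {I. ideal I \<and> I \<noteq> {0}}"

definition artinian :: bool where
  "artinian \<longleftrightarrow> (\<forall>c :: nat \<Rightarrow> 'b set. (\<forall>i. ideal (c i)) \<and> (\<forall>i. c (Suc i) \<subseteq> c i) \<longrightarrow>
     (\<exists>N. \<forall>i\<ge>N. c i = c N))"

definition noetherian :: bool where
  "noetherian \<longleftrightarrow> (\<forall>c :: nat \<Rightarrow> 'b set. (\<forall>i. ideal (c i)) \<and> (\<forall>i. c i \<subseteq> c (Suc i)) \<longrightarrow>
     (\<exists>N. \<forall>i\<ge>N. c i = c N))"

definition uniserial :: bool where
  "uniserial \<longleftrightarrow> (\<forall>I J. ideal I \<and> ideal J \<longrightarrow> I \<subseteq> J \<or> J \<subseteq> I)"

text \<open>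
  The ordinal number of the set of nonzero ideals ordered by inclusion. The algebra itself counts
  as an ideal, so if this set is order isomorphic to an interval \<open>[1, \<lambda>]\<close> of ordinals with
  \<open>\<lambda>\<close> infinite, then the ordinal number is \<open>\<lambda> + 1\<close> rather than \<open>\<lambda>\<close>
  (for example \<open>[1, \<omega>]\<close> has order type \<open>\<omega> + 1\<close>).
\<close>

definition uniserial_dim :: ordinal where
  "uniserial_dim = ord_of {(I, J). I \<in> nonzero_ideals \<and> J \<in> nonzero_ideals \<and> I \<subseteq> J}"

end


section \<open>Triangular polynomial derivations\<close>

text \<open>
  Polynomials in the variables \<open>x\<^sub>0, x\<^sub>1, \<dots>\<close>; a monomial is its finitely supported exponent
  vector. Only \<open>x\<^sub>1, \<dots>, x\<^sub>n\<close> occur in the elements of \<open>poly_ring n\<close>.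
\<close>

type_synonym 'k mpoly = "(nat \<Rightarrow>\<^sub>0 nat) \<Rightarrow>\<^sub>0 'k"

definition poly_ring :: "nat \<Rightarrow> 'k::zero mpoly set" where
  "poly_ring n = {p. \<forall>m\<in>Poly_Mapping.keys p. Poly_Mapping.keys m \<subseteq> {1..n}}"

definition partial :: "nat \<Rightarrow> 'k::comm_semiring_1 mpoly \<Rightarrow> 'k mpoly" where
  "partial i p =
     (\<Sum>m\<in>Poly_Mapping.keys p. Poly_Mapping.single (m - Poly_Mapping.single i 1)
                     (of_nat (Poly_Mapping.lookup m i) * Poly_Mapping.lookup p m))"

text \<open>
  Elements of \<open>Der\<^sub>K(P\<^sub>n)\<close> are maps on \<open>P\<^sub>n = poly_ring n\<close>; they are represented by functions
  that vanish outside of \<open>poly_ring n\<close>. With this convention the vector space operations are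
  pointwise and the Lie bracket is the plain commutator.
\<close>

definition der :: "nat \<Rightarrow> 'k mpoly \<Rightarrow> nat \<Rightarrow> 'k::comm_semiring_1 mpoly \<Rightarrow> 'k mpoly" where
  "der n q i = (\<lambda>p. if p \<in> poly_ring n then q * partial i p else 0)"

definition scale_der :: "'k \<Rightarrow> ('k::comm_semiring_1 mpoly \<Rightarrow> 'k mpoly) \<Rightarrow> 'k mpoly \<Rightarrow> 'k mpoly" where
  "scale_der c D = (\<lambda>p. Poly_Mapping.single 0 c * D p)"

definition commutator :: "('b::ab_group_add \<Rightarrow> 'b) \<Rightarrow> ('b \<Rightarrow> 'b) \<Rightarrow> 'b \<Rightarrow> 'b" where
  "commutator D E = (D \<circ> E) - (E \<circ> D)"

definition triangular :: "nat \<Rightarrow> ('k::comm_semiring_1 mpoly \<Rightarrow> 'k mpoly) set" where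
  "triangular n = {\<Sum>i=1..n. der n (q i) i | q. \<forall>i\<in>{1..n}. q i \<in> poly_ring (i - 1)}"

lemma lookup_partial:
  "Poly_Mapping.lookup (partial i p) m =
     of_nat (Suc (Poly_Mapping.lookup m i)) * Poly_Mapping.lookup p (m + Poly_Mapping.single i 1)"
proof -
  let ?e = "Poly_Mapping.single i (1::nat)"
  let ?g = "\<lambda>k. of_nat (Poly_Mapping.lookup k i) * Poly_Mapping.lookup p k"
  have eq: "k = m + ?e" if "k - ?e = m" "Poly_Mapping.lookup k i \<noteq> 0" for k
  proof (rule poly_mapping_eqI)
    fix j show "Poly_Mapping.lookup k j = Poly_Mapping.lookup (m + ?e) j"
      using that(2) unfolding that(1)[symmetric]
      by (cases "i = j") (auto simp: lookup_add lookup_minus lookup_single)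
  qed
  have "Poly_Mapping.lookup (partial i p) m = (\<Sum>k\<in>Poly_Mapping.keys p. (?g k when k - ?e = m))"
    by (simp add: partial_def lookup_sum lookup_single)
  also have "\<dots> = (\<Sum>k\<in>Poly_Mapping.keys p. (?g k when k = m + ?e))"
  proof (rule sum.cong[OF refl])
    fix k show "(?g k when k - ?e = m) = (?g k when k = m + ?e)"
    proof (cases "Poly_Mapping.lookup k i = 0")
      case False
      then have "k - ?e = m \<longleftrightarrow> k = m + ?e" using eq by auto
      then show ?thesis by simp
    qed simp
  qed
  also have "\<dots> = ?g (m + ?e)"
    by (cases "m + ?e \<in> Poly_Mapping.keys p") (auto simp: when_def sum.delta in_keys_iff)
  finally show ?thesis by (simp add: lookup_add)
qed

lemma partial_add: "partial i (p + q) = partial i p + partial i q"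
  by (rule poly_mapping_eqI) (simp add: lookup_partial lookup_add distrib_left)

lemma partial_0 [simp]: "partial i 0 = 0"
  by (simp add: partial_def)

lemma partial_sum: "partial i (sum f A) = (\<Sum>a\<in>A. partial i (f a))"
  by (induction A rule: infinite_finite_induct) (auto simp: partial_add)

lemma partial_diff:
  fixes p q :: "'k::comm_ring_1 mpoly"
  shows "partial i (p - q) = partial i p - partial i q"
  by (rule poly_mapping_eqI) (simp add: lookup_partial lookup_minus right_diff_distrib)

lemma partial_single:
  "partial i (Poly_Mapping.single m c) =
     Poly_Mapping.single (m - Poly_Mapping.single i 1) (of_nat (Poly_Mapping.lookup m i) * c)"
  by (cases "c = 0") (simp_all add: partial_def)

lemma mpoly_eq_sum: "p = (\<Sum>m\<in>Poly_Mapping.keys p. Poly_Mapping.single m (Poly_Mapping.lookup p m))"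
proof (rule poly_mapping_eqI)
  fix k
  show "Poly_Mapping.lookup p k = Poly_Mapping.lookup
      (\<Sum>m\<in>Poly_Mapping.keys p. Poly_Mapping.single m (Poly_Mapping.lookup p m)) k"
    by (cases "k \<in> Poly_Mapping.keys p") (auto simp: lookup_sum lookup_single when_def sum.delta' in_keys_iff)
qed

lemma partial_mult: "partial i (p * q) = p * partial i q + partial i p * q"
proof -
  let ?e = "Poly_Mapping.single i (1::nat)"
  have mono: "partial i (Poly_Mapping.single k a * Poly_Mapping.single m b) =
      Poly_Mapping.single k a * partial i (Poly_Mapping.single m b) +
      partial i (Poly_Mapping.single k a) * Poly_Mapping.single m b" for k m and a b :: 'a
  proof -
    have *: "k + (m - ?e) = k + m - ?e" if "Poly_Mapping.lookup m i \<noteq> 0" for k m :: "nat \<Rightarrow>\<^sub>0 nat"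
      using that by (intro poly_mapping_eqI) (auto simp: lookup_add lookup_minus lookup_single when_def)
    have l: "Poly_Mapping.single (k + (m - ?e)) (a * (of_nat (Poly_Mapping.lookup m i) * b)) =
        Poly_Mapping.single (k + m - ?e) (of_nat (Poly_Mapping.lookup m i) * (a * b))"
      by (cases "Poly_Mapping.lookup m i = 0") (simp_all add: * mult.left_commute del: One_nat_def)
    have r: "Poly_Mapping.single (k - ?e + m) (of_nat (Poly_Mapping.lookup k i) * a * b) =
        Poly_Mapping.single (k + m - ?e) (of_nat (Poly_Mapping.lookup k i) * (a * b))"
      using *[of k m] by (cases "Poly_Mapping.lookup k i = 0") (simp_all add: add.commute mult.assoc del: One_nat_def)
    show ?thesis
      unfolding partial_single mult_single l r
      by (simp add: lookup_add single_add[symmetric] algebra_simps)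
  qed
  let ?s = "\<lambda>p m. Poly_Mapping.single m (Poly_Mapping.lookup p m :: 'a)"
  have "partial i ((\<Sum>k\<in>Poly_Mapping.keys p. ?s p k) * (\<Sum>m\<in>Poly_Mapping.keys q. ?s q m)) =
     (\<Sum>k\<in>Poly_Mapping.keys p. ?s p k) * partial i (\<Sum>m\<in>Poly_Mapping.keys q. ?s q m) +
     partial i (\<Sum>k\<in>Poly_Mapping.keys p. ?s p k) * (\<Sum>m\<in>Poly_Mapping.keys q. ?s q m)"
    by (simp add: sum_product partial_sum mono sum.distrib)
  then show ?thesis by (simp flip: mpoly_eq_sum)
qed

lemma partial_commute: "partial i (partial j p) = partial j (partial i p)"
proof (cases "i = j")
  case False
  then show ?thesis
    by (intro poly_mapping_eqI) (simp add: lookup_partial lookup_add lookup_single ac_simps)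
qed simp

lemma poly_ring_0 [simp]: "0 \<in> poly_ring n"
  by (simp add: poly_ring_def)

lemma poly_ring_single: "Poly_Mapping.keys m \<subseteq> {1..n} \<Longrightarrow> Poly_Mapping.single m c \<in> poly_ring n"
  by (cases "c = 0") (auto simp: poly_ring_def)

lemma poly_ring_add:
  fixes p q :: "'k::comm_monoid_add mpoly"
  shows "p \<in> poly_ring n \<Longrightarrow> q \<in> poly_ring n \<Longrightarrow> p + q \<in> poly_ring n"
  using keys_add[of p q] unfolding poly_ring_def by blast

lemma poly_ring_diff:
  fixes p q :: "'k::ab_group_add mpoly"
  shows "p \<in> poly_ring n \<Longrightarrow> q \<in> poly_ring n \<Longrightarrow> p - q \<in> poly_ring n"
  unfolding poly_ring_def
proof safe
  fix m j
  assume *: "\<forall>m\<in>Poly_Mapping.keys p. Poly_Mapping.keys m \<subseteq> {1..n}"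
    "\<forall>m\<in>Poly_Mapping.keys q. Poly_Mapping.keys m \<subseteq> {1..n}"
    "m \<in> Poly_Mapping.keys (p - q)" "j \<in> Poly_Mapping.keys m"
  then have "m \<in> Poly_Mapping.keys p \<or> m \<in> Poly_Mapping.keys q"
    by (auto simp: in_keys_iff lookup_minus)
  with * show "j \<in> {1..n}" by blast
qed

lemma poly_ring_sum:
  "(\<And>a. a \<in> A \<Longrightarrow> f a \<in> poly_ring n) \<Longrightarrow> sum f A \<in> poly_ring n"
  by (induction A rule: infinite_finite_induct) (auto simp: poly_ring_add)

lemma poly_ring_mult:
  fixes p q :: "'k::comm_semiring_1 mpoly"
  assumes "p \<in> poly_ring n" "q \<in> poly_ring n"
  shows "p * q \<in> poly_ring n"
  unfolding poly_ring_def
proof safe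
  fix m j assume "m \<in> Poly_Mapping.keys (p * q)" "j \<in> Poly_Mapping.keys m"
  then obtain a b where "a \<in> Poly_Mapping.keys p" "b \<in> Poly_Mapping.keys q" "m = a + b"
    using keys_mult[of p q] by auto
  with assms \<open>j \<in> Poly_Mapping.keys m\<close> keys_add[of a b] show "j \<in> {1..n}"
    unfolding poly_ring_def by blast
qed

lemma poly_ring_mono: "m \<le> n \<Longrightarrow> poly_ring m \<subseteq> poly_ring n"
  unfolding poly_ring_def by fastforce

lemma poly_ring_partial: "p \<in> poly_ring n \<Longrightarrow> partial i p \<in> poly_ring n"
  unfolding poly_ring_def
proof safe
  fix m j
  assume *: "\<forall>m\<in>Poly_Mapping.keys p. Poly_Mapping.keys m \<subseteq> {1..n}"
    "m \<in> Poly_Mapping.keys (partial i p)" "j \<in> Poly_Mapping.keys m"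
  then have "m + Poly_Mapping.single i 1 \<in> Poly_Mapping.keys p"
    "j \<in> Poly_Mapping.keys (m + Poly_Mapping.single i 1)"
    by (auto simp: in_keys_iff lookup_partial lookup_add)
  with * show "j \<in> {1..n}" by blast
qed

lemma partial_eq_0:
  assumes "p \<in> poly_ring k" "k < i"
  shows "partial i p = 0"
proof (rule poly_mapping_eqI)
  fix m :: "nat \<Rightarrow>\<^sub>0 nat"
  have "i \<in> Poly_Mapping.keys (m + Poly_Mapping.single i 1)" by (simp add: in_keys_iff lookup_add)
  with assms have "m + Poly_Mapping.single i 1 \<notin> Poly_Mapping.keys p"
    unfolding poly_ring_def by force
  then show "Poly_Mapping.lookup (partial i p) m = Poly_Mapping.lookup 0 m"
    by (simp add: lookup_partial in_keys_iff)
qed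

lemma sum_fun_apply: "sum f A x = (\<Sum>a\<in>A. f a x)"
  by (induction A rule: infinite_finite_induct) auto

lemma triangularD:
  assumes "D \<in> triangular n"
  shows "\<exists>q. (\<forall>i\<in>{1..n}. q i \<in> poly_ring (i - 1)) \<and>
    (\<forall>p. D p = (if p \<in> poly_ring n then \<Sum>i=1..n. q i * partial i p else 0))"
proof -
  obtain q where "\<forall>i\<in>{1..n}. q i \<in> poly_ring (i - 1)" "D = (\<Sum>i=1..n. der n (q i) i)"
    using assms unfolding triangular_def by blast
  then show ?thesis by (intro exI[of _ q]) (simp add: sum_fun_apply der_def)
qed

lemma triangularI:
  assumes "\<And>i. i \<in> {1..n} \<Longrightarrow> q i \<in> poly_ring (i - 1)"
    and "\<And>p. D p = (if p \<in> poly_ring n then \<Sum>i=1..n. q i * partial i p else 0)"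
  shows "D \<in> triangular n"
  unfolding triangular_def
proof (intro CollectI exI[of _ q] conjI ballI)
  show "D = (\<Sum>i=1..n. der n (q i) i)" by (rule ext) (simp add: assms(2) sum_fun_apply der_def)
qed (use assms in auto)

text \<open>The elements of \<^const>\<open>triangular\<close> are \<open>K\<close>-linear derivations of \<open>poly_ring n\<close>.\<close>

lemma triangular_derivation:
  assumes "D \<in> triangular n" "p \<in> poly_ring n" "p' \<in> poly_ring n"
  shows triangular_closed: "D p \<in> poly_ring n"
    and triangular_add: "D (p + p') = D p + D p'"
    and triangular_mult: "D (p * p') = p * D p' + D p * p'"
    and triangular_const: "D (Poly_Mapping.single 0 c) = 0"
proof -
  obtain q where q: "\<And>i. i \<in> {1..n} \<Longrightarrow> q i \<in> poly_ring (i - 1)"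
    and D: "\<And>p. D p = (if p \<in> poly_ring n then \<Sum>i=1..n. q i * partial i p else 0)"
    using triangularD[OF assms(1)] by blast
  have "q i \<in> poly_ring n" if "i \<in> {1..n}" for i
    using q[OF that] poly_ring_mono[of "i - 1" n] that by (auto simp: le_diff_conv)
  then show "D p \<in> poly_ring n"
    unfolding D by (auto intro!: poly_ring_sum poly_ring_mult poly_ring_partial)
  show "D (p + p') = D p + D p'"
    using assms by (simp add: D poly_ring_add partial_add distrib_left sum.distrib)
  show "D (p * p') = p * D p' + D p * p'"
    using assms
    by (simp add: D poly_ring_mult partial_mult distrib_left sum.distrib sum_distrib_left
        sum_distrib_right ac_simps)
  show "D (Poly_Mapping.single 0 c) = 0"
    by (simp add: D partial_single poly_ring_single)
qed

lemma triangular_diff: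
  fixes p p' :: "'k::comm_ring_1 mpoly"
  assumes "D \<in> triangular n" "p \<in> poly_ring n" "p' \<in> poly_ring n"
  shows "D (p - p') = D p - D p'"
  using triangular_add[OF assms(1) poly_ring_diff[OF assms(2,3)] assms(3)] by (simp add: eq_diff_eq)

lemma triangular_outside: "D \<in> triangular n \<Longrightarrow> p \<notin> poly_ring n \<Longrightarrow> D p = 0"
  by (drule triangularD) auto

lemma triangular_zero: "D \<in> triangular n \<Longrightarrow> D 0 = 0"
  by (drule triangularD) auto

lemma triangular_scale:
  assumes "D \<in> triangular n" "p \<in> poly_ring n"
  shows "D (Poly_Mapping.single 0 c * p) = Poly_Mapping.single 0 c * D p"
  using triangular_mult[OF assms(1) _ assms(2), of "Poly_Mapping.single 0 c"]
    triangular_const[OF assms(1) assms(2) assms(2), of c]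
  by (simp add: poly_ring_single)

lemma commutator_apply: "commutator D E p = D (E p) - E (D p)"
  by (simp add: commutator_def)

lemma commutator_triangular:
  fixes D E :: "'k::comm_ring_1 mpoly \<Rightarrow> 'k mpoly"
  assumes D: "D \<in> triangular n" and E: "E \<in> triangular n"
  shows "commutator D E \<in> triangular n"
proof -
  obtain f where f: "\<And>i. i \<in> {1..n} \<Longrightarrow> f i \<in> poly_ring (i - 1)"
    and Df: "\<And>p. D p = (if p \<in> poly_ring n then \<Sum>i=1..n. f i * partial i p else 0)"
    using triangularD[OF D] by blast
  obtain g where g: "\<And>i. i \<in> {1..n} \<Longrightarrow> g i \<in> poly_ring (i - 1)"
    and Eg: "\<And>p. E p = (if p \<in> poly_ring n then \<Sum>i=1..n. g i * partial i p else 0)"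
    using triangularD[OF E] by blast
  define h where "h = (\<lambda>j. (\<Sum>i=1..n. f i * partial i (g j)) - (\<Sum>i=1..n. g i * partial i (f j)))"
  have low: "(\<Sum>i=1..n. a i * partial i b) \<in> poly_ring (j - 1)"
    if "\<And>i. i \<in> {1..n} \<Longrightarrow> a i \<in> poly_ring (i - 1)" "b \<in> poly_ring (j - 1)" "j \<in> {1..n}"
    for a :: "nat \<Rightarrow> 'k mpoly" and b j
  proof (rule poly_ring_sum)
    fix i assume i: "i \<in> {1..n}"
    show "a i * partial i b \<in> poly_ring (j - 1)"
    proof (cases "i < j")
      case True
      then have "a i \<in> poly_ring (j - 1)"
        using that(1)[OF i] poly_ring_mono[of "i - 1" "j - 1"] by (auto simp: diff_le_mono)
      then show ?thesis
        using that(2) by (intro poly_ring_mult poly_ring_partial)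
    next
      case False
      then have "partial i b = 0" using that i by (intro partial_eq_0[of b "j - 1"]) auto
      then show ?thesis by simp
    qed
  qed
  have h: "h j \<in> poly_ring (j - 1)" if "j \<in> {1..n}" for j
    unfolding h_def using that f g by (intro poly_ring_diff low) auto
  show ?thesis
  proof (rule triangularI[OF h])
    fix p :: "'k mpoly"
    show "commutator D E p = (if p \<in> poly_ring n then \<Sum>j=1..n. h j * partial j p else 0)"
    proof (cases "p \<in> poly_ring n")
      case True
      let ?A = "{1..n}"
      have expand: "(\<Sum>i\<in>?A. a i * partial i (\<Sum>j\<in>?A. b j * partial j p)) =
          (\<Sum>j\<in>?A. (\<Sum>i\<in>?A. a i * partial i (b j)) * partial j p) +
          (\<Sum>i\<in>?A. \<Sum>j\<in>?A. a i * b j * partial i (partial j p))" for a b :: "nat \<Rightarrow> 'k mpoly"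
      proof -
        have "(\<Sum>i\<in>?A. a i * partial i (\<Sum>j\<in>?A. b j * partial j p)) =
          (\<Sum>i\<in>?A. \<Sum>j\<in>?A. a i * partial i (b j) * partial j p) +
          (\<Sum>i\<in>?A. \<Sum>j\<in>?A. a i * b j * partial i (partial j p))"
          by (simp add: partial_sum partial_mult sum_distrib_left distrib_left sum.distrib ac_simps)
        also have "(\<Sum>i\<in>?A. \<Sum>j\<in>?A. a i * partial i (b j) * partial j p) =
          (\<Sum>j\<in>?A. (\<Sum>i\<in>?A. a i * partial i (b j)) * partial j p)"
          by (subst sum.swap) (simp add: sum_distrib_right)
        finally show ?thesis .
      qed
      have sym: "(\<Sum>i\<in>?A. \<Sum>j\<in>?A. g i * f j * partial i (partial j p)) =
          (\<Sum>i\<in>?A. \<Sum>j\<in>?A. f i * g j * partial i (partial j p))"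
        by (subst sum.swap) (simp add: partial_commute mult.commute)
      have "D p \<in> poly_ring n" "E p \<in> poly_ring n"
        using D E True by (auto intro: triangular_closed)
      then have "commutator D E p =
          (\<Sum>i\<in>?A. f i * partial i (\<Sum>j\<in>?A. g j * partial j p)) -
          (\<Sum>i\<in>?A. g i * partial i (\<Sum>j\<in>?A. f j * partial j p))"
        using True by (simp add: commutator_apply Df Eg)
      also have "\<dots> = (\<Sum>j\<in>?A. h j * partial j p)"
        unfolding expand sym by (simp add: h_def left_diff_distrib sum_subtractf)
      finally show ?thesis using True by simp
    next
      case False
      then show ?thesis
        using D E by (simp add: commutator_apply triangular_outside triangular_zero)
    qed
  qed
qed

lemma vector_space_scale_der:
  "vector_space (scale_der :: 'k::field \<Rightarrow> ('k mpoly \<Rightarrow> 'k mpoly) \<Rightarrow> 'k mpoly \<Rightarrow> 'k mpoly)"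
  by unfold_locales
     (auto simp: scale_der_def fun_eq_iff distrib_left single_add distrib_right mult_single
       simp flip: mult.assoc)

lemma lie_algebra_triangular:
  "lie_algebra scale_der (triangular n :: ('k::field mpoly \<Rightarrow> 'k mpoly) set) commutator"
proof -
  interpret V: vector_space "scale_der :: 'k \<Rightarrow> ('k mpoly \<Rightarrow> 'k mpoly) \<Rightarrow> 'k mpoly \<Rightarrow> 'k mpoly"
    by (rule vector_space_scale_der)
  let ?L = "triangular n :: ('k mpoly \<Rightarrow> 'k mpoly) set"
  have sub: "V.subspace ?L"
  proof (rule V.subspaceI)
    show "0 \<in> ?L" by (rule triangularI[of _ "\<lambda>_. 0"]) auto
  next
    fix D E assume "D \<in> ?L" "E \<in> ?L"
    obtain f where f: "\<And>i. i \<in> {1..n} \<Longrightarrow> f i \<in> poly_ring (i - 1)"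
      and Df: "\<And>p. D p = (if p \<in> poly_ring n then \<Sum>i=1..n. f i * partial i p else 0)"
      using triangularD[OF \<open>D \<in> ?L\<close>] by blast
    obtain g where g: "\<And>i. i \<in> {1..n} \<Longrightarrow> g i \<in> poly_ring (i - 1)"
      and Eg: "\<And>p. E p = (if p \<in> poly_ring n then \<Sum>i=1..n. g i * partial i p else 0)"
      using triangularD[OF \<open>E \<in> ?L\<close>] by blast
    show "D + E \<in> ?L"
      by (rule triangularI[of _ "\<lambda>i. f i + g i"])
         (auto simp: Df Eg distrib_right sum.distrib intro!: poly_ring_add f[simplified] g[simplified])
  next
    fix c and D assume "D \<in> ?L"
    obtain f where f: "\<And>i. i \<in> {1..n} \<Longrightarrow> f i \<in> poly_ring (i - 1)"
      and Df: "\<And>p. D p = (if p \<in> poly_ring n then \<Sum>i=1..n. f i * partial i p else 0)"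
      using triangularD[OF \<open>D \<in> ?L\<close>] by blast
    show "scale_der c D \<in> ?L"
      by (rule triangularI[of _ "\<lambda>i. Poly_Mapping.single 0 c * f i"])
         (auto simp: Df scale_der_def sum_distrib_left mult.assoc
           intro!: poly_ring_mult poly_ring_single f[simplified])
  qed
  have add: "D (p + p') = D p + D p'" "D (p - p') = D p - D p'"
    "D (Poly_Mapping.single 0 c * p) = Poly_Mapping.single 0 c * D p"
    if "D \<in> ?L" "p \<in> poly_ring n" "p' \<in> poly_ring n" for D p p' c
    using that by (auto simp: triangular_add triangular_diff triangular_scale)
  have ext: "F = G"
    if "\<And>p. p \<in> poly_ring n \<Longrightarrow> F p = G p" "\<And>p. p \<notin> poly_ring n \<Longrightarrow> F p = G p"
    for F G :: "'k mpoly \<Rightarrow> 'k mpoly"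
    using that by (intro ext) blast
  show "lie_algebra scale_der ?L commutator"
  proof unfold_locales
    show "V.subspace ?L" by (rule sub)
  next
    fix D E assume "D \<in> ?L" "E \<in> ?L"
    then show "commutator D E \<in> ?L" by (rule commutator_triangular)
  next
    fix D E F assume DEF: "D \<in> ?L" "E \<in> ?L" "F \<in> ?L"
    note cl = DEF[THEN triangular_closed] and out = DEF[THEN triangular_outside]
      and z = DEF[THEN triangular_zero]
    note s = commutator_apply add[OF DEF(1)] add[OF DEF(2)] add[OF DEF(3)] cl out z
    show "commutator (D + E) F = commutator D F + commutator E F"
      by (rule ext) (simp_all add: s)
    show "commutator D (E + F) = commutator D E + commutator D F"
      by (rule ext) (simp_all add: s)
    show "commutator D (commutator E F) + commutator E (commutator F D) +
        commutator F (commutator D E) = 0"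
      by (rule ext) (simp_all add: s)
  next
    fix c and D E assume DE: "D \<in> ?L" "E \<in> ?L"
    note s = commutator_apply scale_der_def add[OF DE(1)] add[OF DE(2)] DE[THEN triangular_closed]
      DE[THEN triangular_outside] DE[THEN triangular_zero] right_diff_distrib
    show "commutator (scale_der c D) E = scale_der c (commutator D E)"
      by (rule ext) (simp_all add: s)
    show "commutator D (scale_der c E) = scale_der c (commutator D E)"
      by (rule ext) (simp_all add: s)
  next
    fix D assume "D \<in> ?L" show "commutator D D = 0"
      by (simp add: commutator_def)
  qed
qed


section \<open>The monomial basis, its order, and the ideals \<open>I\<^sub>\<lambda>\<close>\<close>

definition Omega :: "nat \<Rightarrow> ((nat \<Rightarrow>\<^sub>0 nat) \<times> nat) set" where
  "Omega n = {(\<alpha>, i). 1 \<le> i \<and> i \<le> n \<and> Poly_Mapping.keys \<alpha> \<subseteq> {1..i - 1}}"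

definition idx_greater :: "(nat \<Rightarrow>\<^sub>0 nat) \<times> nat \<Rightarrow> (nat \<Rightarrow>\<^sub>0 nat) \<times> nat \<Rightarrow> bool" where
  "idx_greater = (\<lambda>(\<alpha>, i) (\<beta>, j). i < j \<or>
     i = j \<and> (\<exists>m. Poly_Mapping.lookup \<alpha> m > Poly_Mapping.lookup \<beta> m \<and>
       (\<forall>k. m < k \<and> k \<le> i - 1 \<longrightarrow>
          Poly_Mapping.lookup \<alpha> k = Poly_Mapping.lookup \<beta> k)))"

definition Omega_rel :: "nat \<Rightarrow> ((nat \<Rightarrow>\<^sub>0 nat) \<times> nat) rel" where
  "Omega_rel n = {(b, a). a \<in> Omega n \<and> b \<in> Omega n \<and> (a = b \<or> idx_greater a b)}"

definition basis_elem :: "nat \<Rightarrow> (nat \<Rightarrow>\<^sub>0 nat) \<times> nat \<Rightarrow> 'k::field mpoly \<Rightarrow> 'k mpoly" where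
  "basis_elem n = (\<lambda>(\<alpha>, i). der n (Poly_Mapping.single \<alpha> 1) i)"

definition basis :: "nat \<Rightarrow> ('k::field mpoly \<Rightarrow> 'k mpoly) set" where
  "basis n = basis_elem n ` Omega n"

definition basis_rel :: "nat \<Rightarrow> ('k::field mpoly \<Rightarrow> 'k mpoly) rel" where
  "basis_rel n = {(basis_elem n b, basis_elem n a) | a b. (b, a) \<in> Omega_rel n}"

definition ord_elem :: "nat \<Rightarrow> ('k::field mpoly \<Rightarrow> 'k mpoly) \<Rightarrow> ordinal" where
  "ord_elem n x = ord_of (Restr (basis_rel n) {y \<in> basis n. (y, x) \<in> basis_rel n})"

text \<open>
  As \<^term>\<open>basis n\<close> is linearly independent, the direct sum of the lines spanned by a subset of
  it is the span of that subset.
\<close>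

definition I_ideal :: "nat \<Rightarrow> ordinal \<Rightarrow> ('k::field mpoly \<Rightarrow> 'k mpoly) set" where
  "I_ideal n l = module.span scale_der {x \<in> basis n. ord_elem n x \<le> l}"

end

theory Submission
  imports Defs
begin

text \<open>
  Monomial derivations satisfy
  \<open>[x\<^sup>\<gamma>\<partial>\<^sub>m, x\<^sup>\<alpha>\<partial>\<^sub>i] = x\<^sup>\<gamma> (\<partial>\<^sub>m x\<^sup>\<alpha>) \<partial>\<^sub>i - x\<^sup>\<alpha> (\<partial>\<^sub>i x\<^sup>\<gamma>) \<partial>\<^sub>m\<close>.
  A nonzero term on the right lies strictly below \<open>x\<^sup>\<alpha>\<partial>\<^sub>i\<close>: in the first one \<open>m < i\<close>, the
  exponent of \<open>x\<^sub>m\<close> drops, and \<open>\<gamma>\<close> changes only the exponents of less significant variables; in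
  the second one \<open>i < m\<close>. Hence the span of an initial segment of the basis is an ideal.

  Conversely, let \<open>u\<close> be an element of an ideal with leading monomial derivation \<open>a\<close>, and let
  \<open>b < a\<close>. Some monomial derivation \<open>c\<close> is such that the leading monomial of \<open>[c, u]\<close> is below
  \<open>a\<close> but not below \<open>b\<close>; its coefficient is that of \<open>a\<close> in \<open>u\<close> times a positive or negative integer,
  and characteristic zero keeps it nonzero. Well-founded induction on the leading monomial puts
  \<open>b\<close> into the ideal. So the ideal contains everything below \<open>a\<close>, and then \<open>a\<close> itself as a
  multiple of the difference of \<open>u\<close> and lower terms. Therefore the ideals are exactly the spans of
  the initial segments of the basis. The argument is carried out for an arbitrary Lie
  algebra with a well-ordered basis that has these two properties (\<open>lie_algebra_ordered_basis\<close>,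
  \<open>ideal_iff_span_ofilter\<close>); \<open>triangular_ordered_basis\<close> supplies the brackets.

  The rest concerns well-orders. An initial segment is determined by its order type, and every
  ordinal up to the order type of the whole occurs (\<open>bij_betw_ordinals_ofilters\<close>). This gives the
  bijection, comparability of ideals and the descending chain condition; the monomials
  \<open>x\<^sub>1\<^sup>k\<partial>\<^sub>n\<close> generate an ascending chain that does not stabilize. All initial segments of a
  well-order of type \<open>\<lambda>\<close>, ordered by inclusion, have type \<open>\<lambda> + 1\<close>, and for infinite \<open>\<lambda>\<close> leaving
  out the empty one does not change this (\<open>nonempty_ofilters_inclusion\<close>). Finally, the order type
  of the index set follows by splitting off the lowest block, the multiples of \<open>\<partial>\<^sub>n\<close>
  (\<open>Omega_rel_Suc\<close>), and, within a block of exponent vectors, the least significant variable, which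
  contributes a factor \<open>\<omega>\<close> on the left (\<open>lex_rel_insert\<close>).
\<close>


section \<open>Isomorphisms, sums and products of well-orders\<close>

text \<open>
  Reflexivity, totality and well-foundedness are least elements of one- and two-element sets and of
  arbitrary sets. For transitivity along \<open>a \<le> b \<le> c\<close> take the least of the three: if it is \<open>a\<close>,
  then \<open>a \<le> c\<close>; if it is \<open>b\<close> or \<open>c\<close>, antisymmetry identifies it with its left neighbour and the
  claim becomes one of the two given comparisons.
\<close>

lemma Well_order_if_least_elements:
  assumes antisym: "\<And>a b. (a, b) \<in> r \<Longrightarrow> (b, a) \<in> r \<Longrightarrow> a = b"
    and least: "\<And>A. A \<subseteq> Field r \<Longrightarrow> A \<noteq> {} \<Longrightarrow> \<exists>a\<in>A. \<forall>b\<in>A. (a, b) \<in> r"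
  shows "Well_order r"
proof -
  have tot: "(a, b) \<in> r \<or> (b, a) \<in> r" if "a \<in> Field r" "b \<in> Field r" for a b
    using least[of "{a, b}"] that by auto
  have "Refl r"
    using tot by (auto intro!: refl_onI)
  moreover have "trans r"
  proof (rule transI)
    fix a b c assume ab: "(a, b) \<in> r" and bc: "(b, c) \<in> r"
    then have "{a, b, c} \<subseteq> Field r" by (auto simp: Field_def)
    from least[OF this] show "(a, c) \<in> r"
    proof (simp, elim disjE conjE)
      assume "(b, a) \<in> r"
      then show ?thesis using antisym[OF ab] bc by simp
    next
      assume "(c, b) \<in> r"
      then show ?thesis using antisym[OF bc] ab by simp
    qed
  qed
  moreover have "antisym r"
    using antisym by (rule antisymI)
  moreover have "Total r"
    using tot by (auto simp: total_on_def)
  moreover have "wf (r - Id)"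
  proof (rule wfI_min)
    fix x and Q :: "'a set" assume "x \<in> Q"
    show "\<exists>z\<in>Q. \<forall>y. (y, z) \<in> r - Id \<longrightarrow> y \<notin> Q"
    proof (cases "Q \<inter> Field r = {}")
      case True
      then show ?thesis using \<open>x \<in> Q\<close> by (auto simp: Field_def)
    next
      case False
      then obtain z where z: "z \<in> Q \<inter> Field r" "\<forall>b\<in>Q \<inter> Field r. (z, b) \<in> r"
        using least[of "Q \<inter> Field r"] by blast
      have "y \<notin> Q" if "(y, z) \<in> r - Id" for y
        using that z(2) antisym[of y z] FieldI1[of y z r] by auto
      with z(1) show ?thesis by blast
    qed
  qed
  moreover have "r \<subseteq> Field r \<times> Field r" by (auto simp: Field_def)
  ultimately show ?thesis
    by (simp add: well_order_on_def linear_order_on_def partial_order_on_def preorder_on_def)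
qed

lemma Well_order_least:
  assumes "Well_order r" "A \<subseteq> Field r" "A \<noteq> {}"
  shows "\<exists>a\<in>A. \<forall>b\<in>A. (a, b) \<in> r"
proof -
  interpret wo_rel r using assms(1) by (simp add: wo_rel_def)
  show ?thesis using minim_in[OF assms(2,3)] minim_least[OF assms(2)] by blast
qed

lemma Well_orderD:
  assumes "Well_order r"
  shows Well_order_refl: "a \<in> Field r \<Longrightarrow> (a, a) \<in> r"
    and Well_order_trans: "(a, b) \<in> r \<Longrightarrow> (b, c) \<in> r \<Longrightarrow> (a, c) \<in> r"
    and Well_order_antisym: "(a, b) \<in> r \<Longrightarrow> (b, a) \<in> r \<Longrightarrow> a = b"
    and Well_order_total: "a \<in> Field r \<Longrightarrow> b \<in> Field r \<Longrightarrow> (a, b) \<in> r \<or> (b, a) \<in> r"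
proof -
  have "Refl r" "trans r" "antisym r" and tot: "Total r"
    using assms
    by (auto simp: well_order_on_def linear_order_on_def partial_order_on_def preorder_on_def)
  then show "a \<in> Field r \<Longrightarrow> (a, a) \<in> r"
    and "(a, b) \<in> r \<Longrightarrow> (b, c) \<in> r \<Longrightarrow> (a, c) \<in> r"
    and "(a, b) \<in> r \<Longrightarrow> (b, a) \<in> r \<Longrightarrow> a = b"
    by (blast dest: refl_onD transD antisymD)+
  show "a \<in> Field r \<Longrightarrow> b \<in> Field r \<Longrightarrow> (a, b) \<in> r \<or> (b, a) \<in> r"
    using tot \<open>Refl r\<close> by (cases "a = b") (auto simp: total_on_def refl_on_def)
qed

text \<open>
  Isomorphisms between concrete well-orders are established in this form, since an injective direct
  image inherits both being a well-order and its order type.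
\<close>

lemma eq_dir_imageI:
  assumes "f ` Field r = Field s"
    and "\<And>a b. a \<in> Field r \<Longrightarrow> b \<in> Field r \<Longrightarrow> (a, b) \<in> r \<longleftrightarrow> (f a, f b) \<in> s"
  shows "s = dir_image r f"
proof (intro set_eqI iffI; clarify)
  fix x y assume xy: "(x, y) \<in> s"
  then have "x \<in> f ` Field r" "y \<in> f ` Field r"
    unfolding assms(1) by (auto intro: FieldI1 FieldI2)
  with xy show "(x, y) \<in> dir_image r f"
    using assms(2) by (auto simp: dir_image_def)
next
  fix x y assume "(x, y) \<in> dir_image r f"
  then show "(x, y) \<in> s"
    using assms(2) by (auto simp: dir_image_def Field_def)
qed

lemma Restr_dir_image:
  assumes "inj_on f (Field r)" "A \<subseteq> Field r"
  shows "Restr (dir_image r f) (f ` A) = dir_image (Restr r A) f"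
proof -
  have "a \<in> A \<and> b \<in> A" if "(a, b) \<in> r" "f a \<in> f ` A" "f b \<in> f ` A" for a b
    using that FieldI1[OF that(1)] FieldI2[OF that(1)] inj_on_image_mem_iff[OF assms(1) _ assms(2)]
    by blast
  then show ?thesis unfolding dir_image_def by blast
qed

lemma ordIso_bijE:
  assumes "r =o s"
  obtains f where "bij_betw f (Field r) (Field s)"
    "\<And>a b. a \<in> Field r \<Longrightarrow> b \<in> Field r \<Longrightarrow> (a, b) \<in> r \<longleftrightarrow> (f a, f b) \<in> s"
proof -
  from assms obtain f where "iso r s f" by (auto simp: ordIso_def)
  then show thesis using that[of f] by (simp add: iso_iff2)
qed

lemma ordIso_countable:
  assumes "r =o s" "countable (Field r)"
  shows "countable (Field s)"
proof -
  obtain f where "bij_betw f (Field r) (Field s)" using assms(1) by (rule ordIso_bijE)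
  then show ?thesis using countable_image[OF assms(2), of f] by (simp add: bij_betw_def)
qed

lemma Field_ordered_sum: "Field (ordered_sum r s) = Inl ` Field r \<union> Inr ` Field s"
  by (fastforce simp: ordered_sum_def Field_def)

lemma ordered_sum_simps [simp]:
  "(Inl a, Inl b) \<in> ordered_sum r s \<longleftrightarrow> (a, b) \<in> r"
  "(Inr c, Inr d) \<in> ordered_sum r s \<longleftrightarrow> (c, d) \<in> s"
  "(Inl a, Inr d) \<in> ordered_sum r s \<longleftrightarrow> a \<in> Field r \<and> d \<in> Field s"
  "(Inr c, Inl b) \<notin> ordered_sum r s"
  by (auto simp: ordered_sum_def)

lemma Field_ordered_prod:
  assumes "Well_order r" "Well_order s"
  shows "Field (ordered_prod r s) = Field r \<times> Field s"
proof (intro equalityI subsetI)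
  fix x assume "x \<in> Field (ordered_prod r s)"
  then show "x \<in> Field r \<times> Field s" by (auto simp: ordered_prod_def Field_def)
next
  fix x assume "x \<in> Field r \<times> Field s"
  then have "(x, x) \<in> ordered_prod r s"
    using Well_order_refl[OF assms(1)] by (auto simp: ordered_prod_def)
  then show "x \<in> Field (ordered_prod r s)" by (rule FieldI1)
qed

lemma Well_order_ordered_sum:
  assumes "Well_order r" "Well_order s"
  shows "Well_order (ordered_sum r s)"
proof (rule Well_order_if_least_elements)
  fix x y assume "(x, y) \<in> ordered_sum r s" "(y, x) \<in> ordered_sum r s"
  then show "x = y"
    using assms[THEN Well_order_antisym] by (cases x; cases y) auto
next
  fix A assume A: "A \<subseteq> Field (ordered_sum r s)" "A \<noteq> {}"
  show "\<exists>a\<in>A. \<forall>b\<in>A. (a, b) \<in> ordered_sum r s"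
  proof (cases "Inl -` A = {}")
    case False
    have "Inl -` A \<subseteq> Field r" using A by (auto simp: Field_ordered_sum)
    from Well_order_least[OF assms(1) this False] obtain a
      where a: "Inl a \<in> A" "\<And>b. Inl b \<in> A \<Longrightarrow> (a, b) \<in> r" by auto
    have "(Inl a, y) \<in> ordered_sum r s" if "y \<in> A" for y
      using that a A(1) by (cases y) (auto simp: Field_ordered_sum)
    with a(1) show ?thesis by blast
  next
    case True
    then have no: "Inl a \<notin> A" for a by blast
    obtain x where "x \<in> A" using A(2) by blast
    with no have "Inr -` A \<noteq> {}" by (cases x) auto
    moreover have "Inr -` A \<subseteq> Field s" using A by (auto simp: Field_ordered_sum)
    ultimately obtain a where a: "Inr a \<in> A" "\<And>b. Inr b \<in> A \<Longrightarrow> (a, b) \<in> s"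
      using Well_order_least[OF assms(2), of "Inr -` A"] by auto
    have "(Inr a, y) \<in> ordered_sum r s" if "y \<in> A" for y
      using that a no by (cases y) auto
    with a(1) show ?thesis by blast
  qed
qed

text \<open>
  The least element of a set of pairs is found by minimizing the second component, which is the most
  significant one, and then the first.
\<close>

lemma Well_order_ordered_prod:
  assumes "Well_order r" "Well_order s"
  shows "Well_order (ordered_prod r s)"
proof (rule Well_order_if_least_elements)
  fix x y assume "(x, y) \<in> ordered_prod r s" "(y, x) \<in> ordered_prod r s"
  then show "x = y"
    using assms[THEN Well_order_antisym] by (auto simp: ordered_prod_def)
next
  fix A assume A: "A \<subseteq> Field (ordered_prod r s)" "A \<noteq> {}"
  then have sub: "A \<subseteq> Field r \<times> Field s" by (simp add: Field_ordered_prod assms)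
  then obtain c where c: "c \<in> snd ` A" "\<And>d. d \<in> snd ` A \<Longrightarrow> (c, d) \<in> s"
  proof -
    have "snd ` A \<subseteq> Field s" "snd ` A \<noteq> {}" using sub A(2) by auto
    then show thesis using that Well_order_least[OF assms(2), of "snd ` A"] by blast
  qed
  let ?B = "{a. (a, c) \<in> A}"
  have "?B \<subseteq> Field r" "?B \<noteq> {}" using sub c(1) by auto
  then obtain a where a: "(a, c) \<in> A" "\<And>b. (b, c) \<in> A \<Longrightarrow> (a, b) \<in> r"
    using Well_order_least[OF assms(1), of ?B] by blast
  have "((a, c), (b, d)) \<in> ordered_prod r s" if "(b, d) \<in> A" for b d
  proof -
    have "(c, d) \<in> s" using c(2)[of d] image_eqI[of d snd "(b, d)" A] that by simp
    moreover have "(a, b) \<in> r" if "c = d" using that a(2) \<open>(b, d) \<in> A\<close> by simp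
    moreover have "a \<in> Field r" "b \<in> Field r" "c \<in> Field s" "d \<in> Field s"
      using a(1) that sub by auto
    ultimately show ?thesis by (auto simp: ordered_prod_def)
  qed
  with a(1) show "\<exists>a\<in>A. \<forall>b\<in>A. (a, b) \<in> ordered_prod r s"
    by (intro bexI[of _ "(a, c)"]) auto
qed

lemma ordered_sum_cong:
  assumes "r =o r'" "s =o s'"
  shows "ordered_sum r s =o ordered_sum r' s'"
proof -
  note wo = ordIso_Well_orderD[OF assms(1)] ordIso_Well_orderD[OF assms(2)]
  obtain f where f: "bij_betw f (Field r) (Field r')"
    "\<And>a b. a \<in> Field r \<Longrightarrow> b \<in> Field r \<Longrightarrow> (a, b) \<in> r \<longleftrightarrow> (f a, f b) \<in> r'"
    using assms(1) by (rule ordIso_bijE) blast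
  obtain g where g: "bij_betw g (Field s) (Field s')"
    "\<And>a b. a \<in> Field s \<Longrightarrow> b \<in> Field s \<Longrightarrow> (a, b) \<in> s \<longleftrightarrow> (g a, g b) \<in> s'"
    using assms(2) by (rule ordIso_bijE) blast
  have "ordered_sum r' s' = dir_image (ordered_sum r s) (map_sum f g)"
  proof (rule eq_dir_imageI)
    show "map_sum f g ` Field (ordered_sum r s) = Field (ordered_sum r' s')"
      using f(1) g(1)
      by (simp add: bij_betw_def Field_ordered_sum image_Un image_image)
        (metis image_image)
  next
    fix x y assume "x \<in> Field (ordered_sum r s)" "y \<in> Field (ordered_sum r s)"
    then show "(x, y) \<in> ordered_sum r s \<longleftrightarrow> (map_sum f g x, map_sum f g y) \<in> ordered_sum r' s'"
      using f(2) g(2) bij_betw_apply[OF f(1)] bij_betw_apply[OF g(1)]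
      by (auto simp: Field_ordered_sum)
  qed
  moreover have "inj_on (map_sum f g) (Field (ordered_sum r s))"
    by (rule inj_onI)
      (auto simp: Field_ordered_sum dest: inj_onD[OF bij_betw_imp_inj_on[OF f(1)]]
        inj_onD[OF bij_betw_imp_inj_on[OF g(1)]])
  ultimately show ?thesis
    using wo by (auto intro: dir_image_ordIso Well_order_ordered_sum)
qed

lemma ordered_prod_cong:
  assumes "r =o r'" "s =o s'"
  shows "ordered_prod r s =o ordered_prod r' s'"
proof -
  note wo = ordIso_Well_orderD[OF assms(1)] ordIso_Well_orderD[OF assms(2)]
  note F = Field_ordered_prod[of r s] Field_ordered_prod[of r' s']
  obtain f where f: "bij_betw f (Field r) (Field r')"
    "\<And>a b. a \<in> Field r \<Longrightarrow> b \<in> Field r \<Longrightarrow> (a, b) \<in> r \<longleftrightarrow> (f a, f b) \<in> r'"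
    using assms(1) by (rule ordIso_bijE) blast
  obtain g where g: "bij_betw g (Field s) (Field s')"
    "\<And>a b. a \<in> Field s \<Longrightarrow> b \<in> Field s \<Longrightarrow> (a, b) \<in> s \<longleftrightarrow> (g a, g b) \<in> s'"
    using assms(2) by (rule ordIso_bijE) blast
  have "ordered_prod r' s' = dir_image (ordered_prod r s) (map_prod f g)"
  proof (rule eq_dir_imageI)
    show "map_prod f g ` Field (ordered_prod r s) = Field (ordered_prod r' s')"
      using f(1) g(1) wo by (simp add: F bij_betw_def map_prod_surj_on)
  next
    fix x y assume "x \<in> Field (ordered_prod r s)" "y \<in> Field (ordered_prod r s)"
    then obtain a c b d where [simp]: "x = (a, c)" "y = (b, d)"
      and mem: "a \<in> Field r" "c \<in> Field s" "b \<in> Field r" "d \<in> Field s"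
      using wo by (auto simp: F)
    have "g c = g d \<longleftrightarrow> c = d"
      using mem g(1) by (auto simp: bij_betw_def dest: inj_onD)
    then show "(x, y) \<in> ordered_prod r s \<longleftrightarrow> (map_prod f g x, map_prod f g y) \<in> ordered_prod r' s'"
      using mem f(2)[of a b] g(2)[of c d] bij_betw_apply[OF f(1)] bij_betw_apply[OF g(1)]
      by (simp add: ordered_prod_def)
  qed
  moreover have "inj_on (map_prod f g) (Field (ordered_prod r s))"
    using f(1) g(1) wo by (simp add: F bij_betw_def map_prod_inj_on)
  ultimately show ?thesis
    using wo by (auto intro: dir_image_ordIso Well_order_ordered_prod)
qed

lemma rep_ord_of:
  assumes "Well_order r" "countable (Field r)"
  shows "rep_ordinal (ord_of r) =o r"
proof -
  obtain s :: "nat rel" where s: "r =o s" using assms by (rule ex_nat_rel)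
  have "s =o s" using ordIso_Well_orderD[OF s] by (simp add: ordIso_reflexive)
  then have "rep_ordinal (abs_ordinal s) =o s" by (rule Quotient3_rep_abs[OF Quotient3_ordinal])
  then show ?thesis
    using s ord_of_iso[OF s] by (metis ordIso_symmetric ordIso_transitive)
qed

lemma rep_ordinal_Well_order: "Well_order (rep_ordinal x)"
  using Quotient3_rep_reflp[OF Quotient3_ordinal] by (rule ordIso_Well_orderD[THEN conjunct1])

lemma ord_of_rep_ordinal: "ord_of (rep_ordinal x) = x"
  using ord_of_iso[OF Quotient3_rep_reflp[OF Quotient3_ordinal]]
  by (simp add: Quotient3_abs_rep[OF Quotient3_ordinal])

text \<open>
  For uncountable well-orders \<open>ord_of\<close> is a default value that need not respect isomorphism,
  whence the countability assumptions here and below.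
\<close>

lemma ord_of_cong: "r =o s \<Longrightarrow> countable (Field r) \<Longrightarrow> ord_of r = ord_of s"
  using ord_of_eq_iff[of r s] ordIso_Well_orderD[of r s] ordIso_countable[of r s] by blast

lemma ord_of_dir_image:
  assumes "Well_order r" "inj_on f (Field r)" "countable (Field r)"
  shows "ord_of (dir_image r f) = ord_of r"
  using ord_of_cong[OF dir_image_ordIso] assms by metis

lemma ord_of_le_iff:
  assumes "Well_order r" "countable (Field r)" "Well_order s" "countable (Field s)"
  shows "ord_of r \<le> ord_of s \<longleftrightarrow> r \<le>o s"
proof -
  have "ord_of r \<le> ord_of s \<longleftrightarrow> rep_ordinal (ord_of r) \<le>o rep_ordinal (ord_of s)"
    by (simp add: less_eq_ordinal_def)
  also have "\<dots> \<longleftrightarrow> r \<le>o s"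
    using rep_ord_of[OF assms(1,2)] rep_ord_of[OF assms(3,4)]
    by (meson ordIso_ordLeq_trans ordIso_symmetric ordLeq_ordIso_trans)
  finally show ?thesis .
qed

text \<open>
  The sum of ordinals is defined through representatives on the natural numbers; this and the next
  lemma allow sums and products of orders on any types.
\<close>

lemma ord_of_plus:
  assumes "Well_order r" "countable (Field r)" "Well_order s" "countable (Field s)"
  shows "ord_of r + ord_of s = ord_of (ordered_sum r s)"
  unfolding plus_ordinal_def
  by (rule ord_of_cong[OF ordered_sum_cong]) (simp_all add: rep_ord_of assms)

lemma ord_of_times:
  assumes "Well_order r" "countable (Field r)" "Well_order s" "countable (Field s)"
  shows "ord_of r * ord_of s = ord_of (ordered_prod r s)"
  unfolding times_ordinal_def
  by (rule ord_of_cong[OF ordered_prod_cong]) (simp_all add: rep_ord_of assms)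

lemma Well_order_singleton: "Well_order {(a, a)}"
  by (rule Well_order_if_least_elements) (auto simp: subset_singleton_iff)

lemma ord_of_singleton: "ord_of {(a, a)} = 1"
proof -
  have "dir_image {((), ())} (\<lambda>_. a) = {(a, a)}" by (auto simp: dir_image_def)
  then show ?thesis
    using ord_of_dir_image[OF Well_order_singleton[of "()"], of "\<lambda>_. a"]
    by (simp add: one_ordinal_def inj_on_def)
qed


section \<open>Initial segments of a well-order\<close>

lemma ofilter_Well_order:
  assumes "Well_order r"
  shows ofilter_under: "ofilter r (under r a)"
    and ofilter_underS: "ofilter r (underS r a)"
    and ofilter_Field: "ofilter r (Field r)"
    and ofilter_iff_underS: "ofilter r A \<longleftrightarrow> (\<exists>a\<in>Field r. A = underS r a) \<or> A = Field r"
    and ofilter_linear: "ofilter r A \<Longrightarrow> ofilter r B \<Longrightarrow> A \<subseteq> B \<or> B \<subseteq> A"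
proof -
  have r: "wo_rel r" using assms by (simp add: wo_rel_def)
  show "ofilter r (under r a)" using r by (rule wo_rel.under_ofilter)
  show "ofilter r (underS r a)" using r by (rule wo_rel.underS_ofilter)
  show "ofilter r (Field r)" using r by (rule wo_rel.Field_ofilter)
  show "ofilter r A \<longleftrightarrow> (\<exists>a\<in>Field r. A = underS r a) \<or> A = Field r"
    using r by (rule wo_rel.ofilter_underS_Field)
  show "ofilter r A \<Longrightarrow> ofilter r B \<Longrightarrow> A \<subseteq> B \<or> B \<subseteq> A"
    using wo_rel.ofilter_linord[OF r] by blast
qed

lemma ofilter_subset_Field: "ofilter r A \<Longrightarrow> A \<subseteq> Field r"
  by (simp add: ofilter_def)

lemma ofilter_downward: "ofilter r A \<Longrightarrow> a \<in> A \<Longrightarrow> (b, a) \<in> r \<Longrightarrow> b \<in> A"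
  by (auto simp: ofilter_def under_def)

lemma under_subset_ofilter_iff:
  assumes "Well_order r" "ofilter r A" "a \<in> Field r"
  shows "under r a \<subseteq> A \<longleftrightarrow> a \<in> A"
  using assms Well_order_refl[of r a] by (auto simp: ofilter_def under_def)

lemma countable_Field_Restr: "countable (Field r) \<Longrightarrow> countable (Field (Restr r A))"
  by (rule countable_subset[OF mono_Field]) auto

lemma ord_of_Restr_le_iff:
  assumes "Well_order r" "countable (Field r)" "ofilter r A" "ofilter r B"
  shows "ord_of (Restr r A) \<le> ord_of (Restr r B) \<longleftrightarrow> A \<subseteq> B"
  by (simp add: ord_of_le_iff Well_order_Restr countable_Field_Restr assms
      ofilter_subset_ordLeq[OF assms(1,3,4)])

text \<open>
  An order embedding of a representative of the smaller ordinal into \<open>r\<close> has an initial segment as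
  its image.
\<close>

lemma le_ord_ofE:
  assumes "Well_order r" "countable (Field r)" "x \<le> ord_of r"
  obtains A where "ofilter r A" "x = ord_of (Restr r A)"
proof -
  let ?s = "rep_ordinal x"
  note wo = rep_ordinal_Well_order[of x]
  have "?s \<le>o r"
    using assms(3) wo by (subst (asm) ord_of_rep_ordinal[symmetric]) (simp add: ord_of_le_iff assms)
  then obtain f where f: "embed ?s r f" by (auto simp: ordLeq_def)
  let ?A = "f ` Field ?s"
  have "iso ?s (Restr r ?A) f"
    using embed_implies_iso_Restr[OF assms(1) wo f] .
  then have "?s =o Restr r ?A"
    using wo Well_order_Restr[OF assms(1)] by (auto simp: ordIso_def)
  then have "x = ord_of (Restr r ?A)"
    using ord_of_cong[of ?s "Restr r ?A"] by (simp add: ord_of_rep_ordinal)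
  with embed_Field_ofilter[OF wo assms(1) f] show thesis by (rule that)
qed

text \<open>
  The least element of a nonempty initial segment forms an initial segment by itself, of type \<open>1\<close>.
\<close>

lemma one_le_ord_of_Restr_iff:
  assumes "Well_order r" "countable (Field r)" "ofilter r A"
  shows "1 \<le> ord_of (Restr r A) \<longleftrightarrow> A \<noteq> {}"
proof
  assume "1 \<le> ord_of (Restr r A)"
  then have "{((), ())} \<le>o Restr r A"
    using ord_of_le_iff[OF Well_order_singleton[of "()"] _ Well_order_Restr[OF assms(1)]
        countable_Field_Restr[OF assms(2)]]
    by (simp add: ord_of_singleton)
  then obtain f where "embed {((), ())} (Restr r A) f" by (auto simp: ordLeq_def)
  then have "f () \<in> Field (Restr r A)"
    using embed_in_Field[of "{((), ())}" "Restr r A" f "()"] by (auto simp: Field_def)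
  then show "A \<noteq> {}" by (auto simp: Field_def)
next
  assume "A \<noteq> {}"
  then obtain a where a: "a \<in> A" "\<forall>b\<in>A. (a, b) \<in> r"
    using Well_order_least[OF assms(1) ofilter_subset_Field[OF assms(3)]] by blast
  have aF: "(a, a) \<in> r" using a by blast
  have "under r a = {a}"
    using a ofilter_downward[OF assms(3) a(1)] Well_order_antisym[OF assms(1)] aF
    by (auto simp: under_def)
  then have "ofilter r {a}" "Restr r {a} = {(a, a)}"
    using ofilter_under[OF assms(1), of a] aF by auto
  then show "1 \<le> ord_of (Restr r A)"
    using ord_of_Restr_le_iff[OF assms(1,2) _ assms(3), of "{a}"] a(1) by (simp add: ord_of_singleton)
qed

text \<open>
  This recovers an initial segment \<open>A\<close> from its order type: \<open>under r a\<close> is contained in \<open>A\<close> if \<open>a\<close>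
  lies in \<open>A\<close>, and otherwise strictly contains \<open>A\<close>, by comparability of initial segments.
\<close>

lemma elements_upto_ord_of_ofilter:
  assumes "Well_order r" "countable (Field r)" "ofilter r A"
  shows "{a \<in> Field r. ord_of (Restr r (under r a)) \<le> ord_of (Restr r A)} = A"
proof -
  have "ord_of (Restr r (under r a)) \<le> ord_of (Restr r A) \<longleftrightarrow> a \<in> A" if "a \<in> Field r" for a
    using ord_of_Restr_le_iff[OF assms(1,2) ofilter_under assms(3)]
      under_subset_ofilter_iff[OF assms(1,3) that] assms(1) by blast
  then show ?thesis using ofilter_subset_Field[OF assms(3)] by blast
qed

lemma bij_betw_ordinals_ofilters:
  assumes "Well_order r" "countable (Field r)"
  shows "bij_betw (\<lambda>l. {a \<in> Field r. ord_of (Restr r (under r a)) \<le> l})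
    {1..ord_of r} {A. ofilter r A \<and> A \<noteq> {}}" (is "bij_betw ?f ?O ?N")
proof (rule bij_betw_byWitness[where f' = "\<lambda>A. ord_of (Restr r A)"])
  have *: "ord_of (Restr r (?f l)) = l \<and> ?f l \<in> ?N" if l: "l \<in> ?O" for l
  proof -
    obtain A where A: "ofilter r A" "l = ord_of (Restr r A)"
      using l le_ord_ofE[OF assms, of l] by auto
    then have "A \<noteq> {}" using l one_le_ord_of_Restr_iff[OF assms A(1)] by simp
    with A elements_upto_ord_of_ofilter[OF assms A(1)] show ?thesis by simp
  qed
  then show "?f ` ?O \<subseteq> ?N" by blast
  have "Restr r (Field r) = r" by (auto simp: Field_def)
  then have "ord_of (Restr r A) \<le> ord_of r" if "ofilter r A" for A
    using ord_of_Restr_le_iff[OF assms that ofilter_Field[OF assms(1)]] ofilter_subset_Field[OF that]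
    by simp
  then show "(\<lambda>A. ord_of (Restr r A)) ` ?N \<subseteq> ?O"
    using one_le_ord_of_Restr_iff[OF assms] by auto
  show "\<forall>l\<in>?O. ord_of (Restr r (?f l)) = l" using * by blast
  show "\<forall>A\<in>?N. ?f (ord_of (Restr r A)) = A"
    using elements_upto_ord_of_ofilter[OF assms] by simp
qed

text \<open>
  The order types of the members of the chain have a minimum. As initial segments of one well-order
  are ordered like their order types, the chain is constant from such a member on.
\<close>

lemma descending_ofilters_stabilize:
  assumes "Well_order r" "countable (Field r)" "\<And>i. ofilter r (c i)" "\<And>i. c (Suc i) \<subseteq> c i"
  shows "\<exists>N. \<forall>i\<ge>N. c i = c (N :: nat)"
proof -
  let ?P = "\<lambda>l. \<exists>i. l = ord_of (Restr r (c i))"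
  obtain N where N: "(LEAST l. ?P l) = ord_of (Restr r (c N))"
    using LeastI_ex[of ?P] by blast
  have "c N \<subseteq> c i" for i
    using Least_le[of ?P "ord_of (Restr r (c i))"] ord_of_Restr_le_iff[OF assms(1,2) assms(3,3)]
    unfolding N by blast
  moreover have "c i \<subseteq> c N" if "N \<le> i" for i
    using lift_Suc_antimono_le[of c, OF assms(4) that] .
  ultimately show ?thesis by blast
qed

text \<open>
  Every proper initial segment is the set of strict predecessors of an element, and together with the
  whole field this makes up the type of \<open>r\<close> plus one. The empty segment has to be left out, though,
  so the first \<open>\<omega>\<close> elements are shifted by one: an element with finitely many predecessors is sent to
  the segment that it closes, any other one to the segment of its strict predecessors. As \<open>r\<close> is
  infinite, the shift does not run into the whole field.
\<close>

lemma nonempty_ofilters_inclusion: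
  assumes "Well_order r" "countable (Field r)" "infinite (Field r)"
  defines "R \<equiv> {(A, B). ofilter r A \<and> A \<noteq> {} \<and> ofilter r B \<and> B \<noteq> {} \<and> A \<subseteq> B}"
  shows "Well_order R \<and> countable (Field R) \<and> ord_of R = ord_of r + 1"
proof -
  note wo = assms(1)
  let ?s = "ordered_sum r {((), ())}"
  define g where "g = (\<lambda>a. if finite (under r a) then under r a else underS r a)"
  define h where "h = case_sum g (\<lambda>_ :: unit. Field r)"
  have under_eq: "under r a = insert a (underS r a)" if "a \<in> Field r" for a
    using Well_order_refl[OF wo that] by (auto simp: under_def underS_def)
  have lt: "g a \<subset> g b" if "(a, b) \<in> r" "a \<noteq> b" for a b
  proof -
    have F: "a \<in> Field r" "b \<in> Field r" using that by (auto simp: Field_def)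
    have sub: "under r a \<subseteq> underS r b"
      using that Well_order_trans[OF wo] Well_order_antisym[OF wo]
      by (auto simp: under_def underS_def)
    moreover have "b \<notin> underS r b" "a \<notin> underS r a" by (auto simp: underS_def)
    moreover have "finite (under r a)" if "finite (under r b)"
      using that sub under_eq[OF F(2)] by (auto intro: finite_subset)
    moreover have "under r a \<noteq> underS r b" if "finite (under r a)" "infinite (under r b)"
      using that under_eq[OF F(2)] by auto
    ultimately show ?thesis
      using under_eq[OF F(1)] under_eq[OF F(2)] unfolding g_def
      by (cases "finite (under r a)"; cases "finite (under r b)") auto
  qed
  have g: "ofilter r (g a)" "g a \<noteq> {}" "g a \<subset> Field r" if "a \<in> Field r" for a
  proof -
    show of: "ofilter r (g a)"
      using ofilter_under[OF wo] ofilter_underS[OF wo] by (simp add: g_def)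
    show "g a \<noteq> {}" using under_eq[OF that] by (auto simp: g_def)
    have "g a \<noteq> Field r" using that assms(3) by (auto simp: g_def underS_def)
    with ofilter_subset_Field[OF of] show "g a \<subset> Field r" by blast
  qed
  have g_le: "(a, b) \<in> r \<longleftrightarrow> g a \<subseteq> g b" if "a \<in> Field r" "b \<in> Field r" for a b
    using lt[of a b] lt[of b a] Well_order_total[OF wo that] Well_order_refl[OF wo that(1)]
    by (cases "a = b") auto
  have ex: "\<exists>a\<in>Field r. A = g a" if A: "ofilter r A" "A \<noteq> {}" "A \<noteq> Field r" for A
  proof -
    obtain b where b: "b \<in> Field r" "A = underS r b"
      using A ofilter_iff_underS[OF wo] by blast
    show ?thesis
    proof (cases "finite (under r b)")
      case False
      then show ?thesis using b by (auto simp: g_def)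
    next
      case True
      then have "finite A" using b under_eq by simp
      have AF: "A \<subseteq> Field r" using A(1) by (rule ofilter_subset_Field)
      have "\<exists>a\<in>B. \<forall>b\<in>B. (b, a) \<in> r" if "finite B" "B \<noteq> {}" "B \<subseteq> Field r" for B
        using that
      proof (induction rule: finite_ne_induct)
        case (singleton x)
        then show ?case using Well_order_refl[OF wo] by auto
      next
        case (insert x B)
        then obtain a where a: "a \<in> B" "\<forall>b\<in>B. (b, a) \<in> r" by auto
        have "a \<in> Field r" "x \<in> Field r" using a insert.prems by auto
        then consider "(x, a) \<in> r" | "(a, x) \<in> r" using Well_order_total[OF wo] by blast
        then show ?case
        proof cases
          case 1
          then show ?thesis using a by auto
        next
          case 2
          then have "\<forall>b\<in>insert x B. (b, x) \<in> r"
            using a Well_order_trans[OF wo] Well_order_refl[OF wo \<open>x \<in> Field r\<close>] by blast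
          then show ?thesis by blast
        qed
      qed
      from this[OF \<open>finite A\<close> A(2) AF] obtain a where a: "a \<in> A" "\<forall>b\<in>A. (b, a) \<in> r" by blast
      then have "A \<subseteq> under r a" by (auto simp: under_def)
      moreover have "under r a \<subseteq> A" using a(1) A(1) by (simp add: ofilter_def)
      ultimately have "under r a = A" by blast
      with a AF \<open>finite A\<close> show ?thesis by (auto simp: g_def)
    qed
  qed
  have "r \<noteq> {}" using assms(3) by auto
  then have Fne: "Field r \<noteq> {}" by (auto simp: Field_def)
  have F1: "Field {((), ())} = {()}" by (simp add: Field_def)
  then have F: "Field ?s = Inl ` Field r \<union> {Inr ()}"
    by (simp add: Field_ordered_sum)
  have FR: "Field R = {A. ofilter r A \<and> A \<noteq> {}}"
    by (auto simp: R_def Field_def)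
  have h: "h (Inl a) = g a" "h (Inr u) = Field r" for a u by (simp_all add: h_def)
  have img: "h ` Field ?s = Field R"
  proof (intro equalityI subsetI)
    fix A assume "A \<in> h ` Field ?s"
    then show "A \<in> Field R" using g Fne ofilter_Field[OF wo] by (auto simp: F FR h)
  next
    fix A assume "A \<in> Field R"
    then show "A \<in> h ` Field ?s" using ex[of A] by (cases "A = Field r") (auto simp: F FR h image_Un image_image)
  qed
  have R: "(A, B) \<in> R \<longleftrightarrow> A \<in> Field R \<and> B \<in> Field R \<and> A \<subseteq> B" for A B
    unfolding FR by (auto simp: R_def)
  have iff: "(x, y) \<in> ?s \<longleftrightarrow> h x \<subseteq> h y" if "x \<in> Field ?s" "y \<in> Field ?s" for x y
  proof -
    have "\<not> Field r \<subseteq> g a" "g a \<subseteq> Field r" if "a \<in> Field r" for a using g(3)[OF that] by auto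
    then show ?thesis
      using that by (cases x; cases y) (auto simp: F F1 h g_le)
  qed
  have "R = dir_image ?s h"
    using img iff by (intro eq_dir_imageI) (auto simp: R)
  moreover have wos: "Well_order ?s"
    by (rule Well_order_ordered_sum[OF wo Well_order_singleton])
  moreover have inj: "inj_on h (Field ?s)"
    by (rule inj_onI) (metis Well_order_antisym[OF wos] iff order_refl)
  moreover have "countable (Field ?s)" using assms(2) by (simp add: F)
  moreover have "ord_of ?s = ord_of r + 1"
    using ord_of_plus[OF wo assms(2) Well_order_singleton[of "()"]]
    by (simp add: ord_of_singleton Field_def)
  ultimately show ?thesis
    using Well_order_dir_image[OF wos inj] ord_of_dir_image[OF wos inj]
    by (simp add: dir_image_Field)
qed


section \<open>Ideals of a Lie algebra with a well-ordered basis\<close>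

text \<open>
  The basis is indexed by a well-order. A bracket with a basis element never raises the leading
  term (\<open>bracket_lowers\<close>). Conversely, from \<open>X a\<close> one can come down to any \<open>b < a\<close> in
  steps: a bracket with some \<open>X c\<close> leads to a multiple of \<open>X a'\<close> with \<open>b \<le> a' < a\<close>, and it does so
  for every element with leading index \<open>a\<close>, because it takes the lower terms below \<open>a'\<close>
  (\<open>bracket_reaches\<close>). A single step need not arrive at \<open>b\<close>.
\<close>

locale lie_algebra_ordered_basis = lie_algebra scale L bracket
  for scale :: "'k::field \<Rightarrow> 'b::ab_group_add \<Rightarrow> 'b" and L and bracket +
  fixes r :: "'i rel" and X :: "'i \<Rightarrow> 'b"
  assumes wo: "Well_order r"
    and inj_X: "inj_on X (Field r)"
    and independent_X: "independent (X ` Field r)"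
    and span_X: "span (X ` Field r) = L"
    and bracket_lowers: "\<lbrakk>c \<in> Field r; a \<in> Field r\<rbrakk> \<Longrightarrow> bracket (X c) (X a) \<in> span (X ` under r a)"
    and bracket_reaches: "\<lbrakk>(b, a) \<in> r; b \<noteq> a\<rbrakk> \<Longrightarrow> \<exists>c\<in>Field r. \<exists>a' s.
      (b, a') \<in> r \<and> (a', a) \<in> r \<and> a' \<noteq> a \<and> s \<noteq> 0 \<and> bracket (X c) (X a) = scale s (X a') \<and>
      (\<forall>d\<in>underS r a. bracket (X c) (X d) \<in> span (X ` underS r a'))"
begin

lemma span_subset_L: "A \<subseteq> Field r \<Longrightarrow> span (X ` A) \<subseteq> L"
  unfolding span_X[symmetric] by (intro span_mono image_mono)

lemma X_in_L: "a \<in> Field r \<Longrightarrow> X a \<in> L"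
  unfolding span_X[symmetric] by (simp add: span_base)

lemma bracket_span_right:
  assumes "x \<in> L" "S \<subseteq> L" "subspace V" "\<And>s. s \<in> S \<Longrightarrow> bracket x s \<in> V" "y \<in> span S"
  shows "bracket x y \<in> V"
proof -
  have "y \<in> L \<and> bracket x y \<in> V"
    using assms(5)
  proof (induction rule: span_induct_alt)
    case base
    have "bracket x 0 = 0"
      using bracket_scale_right[OF assms(1,1), of 0] by simp
    then show ?case using subspace_0[OF assms(3)] subspace_0[OF subspace_L] by simp
  next
    case (step c s y)
    then have "s \<in> L" "scale c s \<in> L" "y \<in> L" using assms(2) subspace_scale[OF subspace_L] by auto
    then show ?case
      using step assms by (simp add: bracket_add_right bracket_scale_right subspace_add[OF subspace_L]
          subspace_add subspace_scale)
  qed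
  then show ?thesis ..
qed

lemma bracket_span_left:
  assumes "y \<in> L" "S \<subseteq> L" "subspace V" "\<And>s. s \<in> S \<Longrightarrow> bracket s y \<in> V" "x \<in> span S"
  shows "bracket x y \<in> V"
proof -
  have "x \<in> L \<and> bracket x y \<in> V"
    using assms(5)
  proof (induction rule: span_induct_alt)
    case base
    have "bracket 0 y = 0"
      using bracket_scale_left[OF assms(1,1), of 0] by simp
    then show ?case using subspace_0[OF assms(3)] subspace_0[OF subspace_L] by simp
  next
    case (step c s x)
    then have "s \<in> L" "scale c s \<in> L" "x \<in> L" using assms(2) subspace_scale[OF subspace_L] by auto
    then show ?case
      using step assms by (simp add: bracket_add_left bracket_scale_left subspace_add[OF subspace_L]
          subspace_add subspace_scale)
  qed
  then show ?thesis ..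
qed

lemma ideal_span_ofilter:
  assumes "ofilter r A"
  shows "ideal (span (X ` A))"
  unfolding ideal_def
proof (intro conjI ballI)
  have AF: "A \<subseteq> Field r" using assms by (rule ofilter_subset_Field)
  then show L: "span (X ` A) \<subseteq> L" by (rule span_subset_L)
  have "X ` A \<subseteq> L" using AF X_in_L by auto
  fix x y assume x: "x \<in> L" and y: "y \<in> span (X ` A)"
  have "bracket (X c) y \<in> span (X ` A)" if c: "c \<in> Field r" for c
  proof (rule bracket_span_right[OF X_in_L[OF c] \<open>X ` A \<subseteq> L\<close> subspace_span _ y])
    fix s assume "s \<in> X ` A"
    then obtain a where a: "a \<in> A" "s = X a" by blast
    then have "under r a \<subseteq> A" "a \<in> Field r" using assms AF by (auto simp: ofilter_def)
    then show "bracket (X c) s \<in> span (X ` A)"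
      using bracket_lowers[OF c \<open>a \<in> Field r\<close>] span_mono[OF image_mono[of "under r a" A X]] a(2) by blast
  qed
  then have gen: "bracket s y \<in> span (X ` A)" if "s \<in> X ` Field r" for s
    using that by blast
  have yL: "y \<in> L" and xS: "x \<in> span (X ` Field r)"
    using x subsetD[OF L y] by (simp_all add: span_X)
  have XL: "X ` Field r \<subseteq> L" using X_in_L by blast
  show "bracket x y \<in> span (X ` A)"
    by (rule bracket_span_left[OF yL XL subspace_span gen xS])
qed simp

lemma X_in_span_iff:
  assumes "a \<in> Field r" "B \<subseteq> Field r"
  shows "X a \<in> span (X ` B) \<longleftrightarrow> a \<in> B"
proof
  assume *: "X a \<in> span (X ` B)"
  show "a \<in> B"
  proof (rule ccontr)
    assume "a \<notin> B"
    then have "X a \<notin> X ` B" using assms inj_on_image_mem_iff[OF inj_X] by blast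
    then have "X ` B \<subseteq> X ` Field r - {X a}" using assms(2) by blast
    then have "X a \<in> span (X ` Field r - {X a})" using * span_mono by blast
    then show False using independent_X assms(1) by (auto simp: dependent_def)
  qed
qed (simp add: span_base)

lemma span_subset_span_iff:
  assumes "A \<subseteq> Field r" "B \<subseteq> Field r"
  shows "span (X ` A) \<subseteq> span (X ` B) \<longleftrightarrow> A \<subseteq> B"
proof
  assume *: "span (X ` A) \<subseteq> span (X ` B)"
  show "A \<subseteq> B"
  proof
    fix a assume "a \<in> A"
    then have "X a \<in> span (X ` B)" using * span_base[of "X a" "X ` A"] by blast
    with \<open>a \<in> A\<close> assms show "a \<in> B" using X_in_span_iff by blast
  qed
qed (intro span_mono image_mono)

text \<open>
  Through spans the leading index is available without choosing coordinates.
\<close>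

definition leading :: "'b \<Rightarrow> 'i \<Rightarrow> bool" where
  "leading u a \<longleftrightarrow> a \<in> Field r \<and> u \<in> span (X ` under r a) \<and> u \<notin> span (X ` underS r a)"

text \<open>
  A combination of finitely many basis elements is controlled by the largest of their indices.
\<close>

lemma span_directed:
  assumes "A \<subseteq> Field r" "u \<in> span (X ` A)"
  shows "u = 0 \<or> (\<exists>a\<in>A. u \<in> span (X ` under r a))"
  using assms(2)
proof (induction rule: span_induct_alt)
  case base
  then show ?case by simp
next
  case (step c x y)
  then obtain a where a: "a \<in> A" "x = X a" by blast
  have x: "scale c x \<in> span (X ` under r b)" if "(a, b) \<in> r" for b
    using that a by (intro span_scale span_base) (auto simp: under_def)
  have aF: "a \<in> Field r" using a assms by auto
  show ?case
  proof (cases "y = 0")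
    case True
    then show ?thesis using x Well_order_refl[OF wo aF] a by auto
  next
    case False
    with step obtain b where b: "b \<in> A" "y \<in> span (X ` under r b)" by blast
    then have bF: "b \<in> Field r" using assms by auto
    from Well_order_total[OF wo aF bF] show ?thesis
    proof
      assume "(a, b) \<in> r"
      then show ?thesis using span_add[OF x b(2)] b(1) by blast
    next
      assume "(b, a) \<in> r"
      then have "under r b \<subseteq> under r a"
        using Well_order_trans[OF wo] by (auto simp: under_def)
      then have "y \<in> span (X ` under r a)"
        using b(2) span_mono[OF image_mono] by blast
      then show ?thesis using span_add[OF x] Well_order_refl[OF wo aF] a(1) by blast
    qed
  qed
qed

lemma ex_leading:
  assumes "u \<in> L" "u \<noteq> 0"
  shows "\<exists>a. leading u a"
proof -
  let ?A = "{a \<in> Field r. u \<in> span (X ` under r a)}"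
  have "?A \<noteq> {}" using span_directed[of "Field r" u] assms by (auto simp: span_X)
  then obtain a where a: "a \<in> Field r" "u \<in> span (X ` under r a)"
    and least: "\<And>b. b \<in> Field r \<Longrightarrow> u \<in> span (X ` under r b) \<Longrightarrow> (a, b) \<in> r"
    using Well_order_least[OF wo, of ?A] by blast
  have "u \<notin> span (X ` underS r a)"
  proof
    assume "u \<in> span (X ` underS r a)"
    then obtain b where "b \<in> underS r a" "u \<in> span (X ` under r b)"
      using span_directed[of "underS r a" u] assms(2) by (auto simp: underS_def Field_def)
    then show False
      using least[of b] Well_order_antisym[OF wo, of a b] by (auto simp: underS_def Field_def)
  qed
  with a show ?thesis by (auto simp: leading_def)
qed

lemma under_eq_insert: "a \<in> Field r \<Longrightarrow> under r a = insert a (underS r a)"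
  using Well_order_refl[OF wo] by (auto simp: under_def underS_def)

lemma leading_decompose:
  assumes "leading u a"
  obtains k where "k \<noteq> 0" "u - scale k (X a) \<in> span (X ` underS r a)"
proof -
  have "u \<in> span (insert (X a) (X ` underS r a))"
    using assms under_eq_insert[of a] by (simp add: leading_def)
  then obtain k where k: "u - scale k (X a) \<in> span (X ` underS r a)"
    by (auto simp: span_breakdown_eq)
  moreover have "k \<noteq> 0" using k assms by (auto simp: leading_def)
  ultimately show thesis using that by blast
qed

lemma leadingI:
  assumes "a \<in> Field r" "k \<noteq> 0" "u - scale k (X a) \<in> span (X ` underS r a)"
  shows "leading u a"
  unfolding leading_def
proof (intro conjI)
  show "u \<in> span (X ` under r a)"
    using assms under_eq_insert[of a] by (auto simp: span_breakdown_eq)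
  show "u \<notin> span (X ` underS r a)"
  proof
    assume "u \<in> span (X ` underS r a)"
    then have "u - (u - scale k (X a)) \<in> span (X ` underS r a)" using assms(3) by (rule span_diff)
    then have "scale (inverse k) (scale k (X a)) \<in> span (X ` underS r a)"
      by (auto dest: span_scale)
    then have "X a \<in> span (X ` underS r a)" using assms(2) by simp
    moreover have "underS r a \<subseteq> Field r" by (auto simp: underS_def Field_def)
    ultimately show False using X_in_span_iff[OF assms(1)] by (auto simp: underS_def)
  qed
qed (fact assms)

lemma wf_strict: "wf (r - Id)"
  using wo by (simp add: well_order_on_def)

text \<open>
  Well-founded induction on the leading index \<open>a\<close>. For \<open>b < a\<close> the bracket provided by
  \<open>bracket_reaches\<close> stays in the ideal and has a smaller leading index \<open>a' \<ge> b\<close>, so the induction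
  hypothesis applies to it. Once all basis elements below \<open>a\<close> are in the ideal, subtracting the
  lower terms of \<open>u\<close> leaves a nonzero multiple of \<open>X a\<close>.
\<close>

lemma basis_below_leading_in_ideal:
  assumes I: "ideal I"
  shows "u \<in> I \<Longrightarrow> leading u a \<Longrightarrow> (b, a) \<in> r \<Longrightarrow> X b \<in> I"
proof (induction a arbitrary: u b rule: wf_induct_rule[OF wf_strict])
  case (1 a)
  have sub: "subspace I" using I by (auto simp: ideal_def)
  have aF: "a \<in> Field r" using "1.prems" by (simp add: leading_def)
  obtain k where k: "k \<noteq> 0" "u - scale k (X a) \<in> span (X ` underS r a)"
    using leading_decompose[OF "1.prems"(2)] .
  define v where "v = u - scale k (X a)"
  have u: "u = scale k (X a) + v" by (simp add: v_def)
  have v: "v \<in> span (X ` underS r a)" using k(2) by (simp add: v_def)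
  have SF: "underS r a \<subseteq> Field r" by (auto simp: underS_def Field_def)
  have SL: "X ` underS r a \<subseteq> L" using SF X_in_L by auto
  have vL: "v \<in> L" using v span_subset_L[OF SF] by auto
  have below: "X b \<in> I" if "(b, a) \<in> r" "b \<noteq> a" for b
  proof -
    obtain c a' s where c: "c \<in> Field r" and a': "(b, a') \<in> r" "(a', a) \<in> r" "a' \<noteq> a"
      and s: "s \<noteq> 0" "bracket (X c) (X a) = scale s (X a')"
      and d: "\<And>d. d \<in> underS r a \<Longrightarrow> bracket (X c) (X d) \<in> span (X ` underS r a')"
      using bracket_reaches[OF \<open>(b, a) \<in> r\<close> \<open>b \<noteq> a\<close>] by blast
    let ?w = "bracket (X c) u"
    have "bracket (X c) v \<in> span (X ` underS r a')"
      using d by (intro bracket_span_right[OF X_in_L[OF c] SL subspace_span _ v]) auto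
    moreover have "?w = scale (k * s) (X a') + bracket (X c) v"
      unfolding u using X_in_L[OF c] X_in_L[OF aF] vL subspace_scale[OF subspace_L]
      by (simp add: bracket_add_right bracket_scale_right s(2))
    moreover have "a' \<in> Field r" using a' by (auto simp: Field_def)
    ultimately have "leading ?w a'"
      using k(1) s(1) by (intro leadingI[of a' "k * s"]) auto
    moreover have "?w \<in> I" using I X_in_L[OF c] "1.prems"(1) by (auto simp: ideal_def)
    ultimately show "X b \<in> I" using "1.IH"[of a' ?w b] a' by blast
  qed
  show "X b \<in> I"
  proof (cases "b = a")
    case False
    then show ?thesis using below "1.prems"(3) by blast
  next
    case True
    have "X ` underS r a \<subseteq> I" using below by (auto simp: underS_def)
    then have "v \<in> I" using v span_minimal[OF _ sub] by blast
    with "1.prems"(1) have "u - v \<in> I" by (rule subspace_diff[OF sub])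
    then have "scale k (X a) \<in> I" by (simp add: u)
    then have "scale (inverse k) (scale k (X a)) \<in> I" by (rule subspace_scale[OF sub])
    then show ?thesis using k(1) True by simp
  qed
qed

lemma ideal_iff_span_ofilter: "ideal I \<longleftrightarrow> (\<exists>A. ofilter r A \<and> I = span (X ` A))"
proof
  assume I: "ideal I"
  then have sub: "subspace I" "I \<subseteq> L" by (auto simp: ideal_def)
  let ?A = "{b \<in> Field r. \<exists>u\<in>I. \<exists>a. leading u a \<and> (b, a) \<in> r}"
  have "ofilter r ?A"
    unfolding ofilter_def under_def
    using Well_order_trans[OF wo] by (blast intro: FieldI1)
  moreover have "I = span (X ` ?A)"
  proof
    show "span (X ` ?A) \<subseteq> I"
      using basis_below_leading_in_ideal[OF I] by (intro span_minimal sub) blast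
    show "I \<subseteq> span (X ` ?A)"
    proof
      fix u assume u: "u \<in> I"
      show "u \<in> span (X ` ?A)"
      proof (cases "u = 0")
        case False
        then obtain a where a: "leading u a" using ex_leading u sub(2) by blast
        then have "under r a \<subseteq> ?A" using u by (auto simp: under_def Field_def)
        then have "span (X ` under r a) \<subseteq> span (X ` ?A)" by (intro span_mono image_mono)
        then show ?thesis using a by (auto simp: leading_def)
      qed (simp add: span_zero)
    qed
  qed
  ultimately show "\<exists>A. ofilter r A \<and> I = span (X ` A)" by blast
qed (auto intro: ideal_span_ofilter)

lemma span_eq_zero_iff: "A \<subseteq> Field r \<Longrightarrow> span (X ` A) = {0} \<longleftrightarrow> A = {}"
  using span_subset_span_iff[of A "{}"] span_zero[of "X ` A"] by auto

lemma nonzero_ideals_eq: "nonzero_ideals = (\<lambda>A. span (X ` A)) ` {A. ofilter r A \<and> A \<noteq> {}}"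
  using span_eq_zero_iff ofilter_subset_Field by (auto simp: nonzero_ideals_def ideal_iff_span_ofilter)

lemma inj_on_span_ofilter: "inj_on (\<lambda>A. span (X ` A)) {A. ofilter r A}"
proof (rule inj_onI)
  fix A B assume "A \<in> {A. ofilter r A}" "B \<in> {A. ofilter r A}" and eq: "span (X ` A) = span (X ` B)"
  then have "A \<subseteq> Field r" "B \<subseteq> Field r" by (auto simp: ofilter_subset_Field)
  then show "A = B"
    using span_subset_span_iff[of A B] span_subset_span_iff[of B A] eq by simp
qed

lemma ideals_uniserial: uniserial
  unfolding uniserial_def ideal_iff_span_ofilter
  using ofilter_linear[OF wo] span_mono image_mono by metis

lemma artinian_if_countable:
  assumes "countable (Field r)"
  shows artinian
  unfolding artinian_def
proof (intro allI impI, elim conjE)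
  fix c :: "nat \<Rightarrow> 'b set" assume c: "\<forall>i. ideal (c i)" "\<forall>i. c (Suc i) \<subseteq> c i"
  then obtain A where A: "\<And>i. ofilter r (A i)" "\<And>i. c i = span (X ` A i)"
    unfolding ideal_iff_span_ofilter by metis
  have "A (Suc i) \<subseteq> A i" for i
    using c(2) A span_subset_span_iff[OF ofilter_subset_Field ofilter_subset_Field] by metis
  from descending_ofilters_stabilize[of r A, OF wo assms A(1) this] show "\<exists>N. \<forall>i\<ge>N. c i = c N"
    unfolding A(2) by metis
qed

text \<open>
  The spans of the initial segments closed by the \<open>a k\<close> form a strictly ascending chain.
\<close>

lemma not_noetherian_if_ascending:
  fixes a :: "nat \<Rightarrow> 'i"
  assumes "\<And>k. (a k, a (Suc k)) \<in> r" "\<And>k. a k \<noteq> a (Suc k)"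
  shows "\<not> noetherian"
proof
  assume noetherian
  let ?c = "\<lambda>k. span (X ` under r (a k))"
  have under_Field: "under r (a k) \<subseteq> Field r" for k by (auto simp: under_def Field_def)
  have "under r (a k) \<subseteq> under r (a (Suc k))" for k
    using Well_order_trans[OF wo _ assms(1)] by (auto simp: under_def)
  then have "\<forall>k. ?c k \<subseteq> ?c (Suc k)" by (intro allI span_mono image_mono)
  moreover have "\<forall>k. ideal (?c k)" using ideal_span_ofilter ofilter_under[OF wo] by blast
  ultimately have "\<exists>N. \<forall>i\<ge>N. ?c i = ?c N"
    by (intro \<open>noetherian\<close>[unfolded noetherian_def, THEN spec, THEN mp] conjI)
  then obtain N where N: "\<forall>i\<ge>N. ?c i = ?c N" ..
  have "?c (Suc N) = ?c N" by (rule N[rule_format]) simp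
  then have "under r (a (Suc N)) \<subseteq> under r (a N)"
    using span_subset_span_iff[OF under_Field under_Field] by blast
  moreover have "a (Suc N) \<in> under r (a (Suc N))"
    using assms(1)[of N] Well_order_refl[OF wo] by (auto simp: under_def Field_def)
  ultimately show False
    using Well_order_antisym[OF wo assms(1)[of N]] assms(2)[of N] by (auto simp: under_def)
qed

lemma uniserial_dim_eq:
  assumes "countable (Field r)" "infinite (Field r)"
  shows "uniserial_dim = ord_of r + 1"
proof -
  let ?R = "{(A, B). ofilter r A \<and> A \<noteq> {} \<and> ofilter r B \<and> B \<noteq> {} \<and> A \<subseteq> B}"
  have F: "Field ?R = {A. ofilter r A \<and> A \<noteq> {}}" by (auto simp: Field_def)
  note R = nonempty_ofilters_inclusion[OF wo assms]
  have "{(I, J). I \<in> nonzero_ideals \<and> J \<in> nonzero_ideals \<and> I \<subseteq> J} =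
      dir_image ?R (\<lambda>A. span (X ` A))"
  proof (rule eq_dir_imageI)
    show "(\<lambda>A. span (X ` A)) ` Field ?R =
        Field {(I, J). I \<in> nonzero_ideals \<and> J \<in> nonzero_ideals \<and> I \<subseteq> J}"
      unfolding F nonzero_ideals_eq[symmetric] by (auto simp: Field_def)
  next
    fix A B assume "A \<in> Field ?R" "B \<in> Field ?R"
    then show "(A, B) \<in> ?R \<longleftrightarrow> (span (X ` A), span (X ` B)) \<in>
        {(I, J). I \<in> nonzero_ideals \<and> J \<in> nonzero_ideals \<and> I \<subseteq> J}"
      unfolding F using span_subset_span_iff[OF ofilter_subset_Field ofilter_subset_Field, of A B]
      by (auto simp: nonzero_ideals_eq)
  qed
  moreover have "inj_on (\<lambda>A. span (X ` A)) (Field ?R)"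
    using inj_on_span_ofilter unfolding F by (rule inj_on_subset) auto
  ultimately show ?thesis
    using R ord_of_dir_image[of ?R "\<lambda>A. span (X ` A)"] by (simp add: uniserial_dim_def)
qed

end


section \<open>The order type of the index set\<close>

text \<open>
  The reverse lexicographic order, in which the variable with the largest index is decisive.
\<close>

definition lex_less :: "(nat \<Rightarrow>\<^sub>0 nat) \<Rightarrow> (nat \<Rightarrow>\<^sub>0 nat) \<Rightarrow> bool" where
  "lex_less \<beta> \<alpha> \<longleftrightarrow> (\<exists>m. Poly_Mapping.lookup \<beta> m < Poly_Mapping.lookup \<alpha> m \<and>
     (\<forall>k>m. Poly_Mapping.lookup \<beta> k = Poly_Mapping.lookup \<alpha> k))"

definition lex_rel :: "nat set \<Rightarrow> (nat \<Rightarrow>\<^sub>0 nat) rel" where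
  "lex_rel V = {(\<beta>, \<alpha>). Poly_Mapping.keys \<beta> \<subseteq> V \<and> Poly_Mapping.keys \<alpha> \<subseteq> V \<and> (\<beta> = \<alpha> \<or> lex_less \<beta> \<alpha>)}"

lemma lex_rel_iff:
  "(\<beta>, \<alpha>) \<in> lex_rel V \<longleftrightarrow>
     Poly_Mapping.keys \<beta> \<subseteq> V \<and> Poly_Mapping.keys \<alpha> \<subseteq> V \<and> (\<beta> = \<alpha> \<or> lex_less \<beta> \<alpha>)"
  by (simp add: lex_rel_def)

lemma lex_less_irrefl: "\<not> lex_less \<alpha> \<alpha>"
  by (simp add: lex_less_def)

lemma keys_subset_iff:
  "Poly_Mapping.keys p \<subseteq> V \<longleftrightarrow> (\<forall>k. k \<notin> V \<longrightarrow> Poly_Mapping.lookup p k = 0)"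
  by (auto simp: in_keys_iff)

lemma Field_lex_rel: "Field (lex_rel V) = {\<alpha>. Poly_Mapping.keys \<alpha> \<subseteq> V}"
  by (auto simp: lex_rel_def Field_def)

text \<open>
  Adding a least significant variable \<open>v\<close> replaces every exponent vector by a copy of the natural
  numbers, the powers of \<open>x\<^sub>v\<close>. Adding variables at this end matches the recursion
  \<open>\<omega>\<^sup>n\<^sup>+\<^sup>1 = \<omega> \<cdot> \<omega>\<^sup>n\<close> of the power operation.
\<close>

lemma lex_rel_insert:
  assumes "\<And>w. w \<in> V \<Longrightarrow> v < w" and "Well_order (lex_rel V)"
  shows "lex_rel (insert v V) =
      dir_image (ordered_prod natLeq (lex_rel V)) (\<lambda>(k, \<alpha>). Poly_Mapping.single v k + \<alpha>)"
    and "inj_on (\<lambda>(k, \<alpha>). Poly_Mapping.single v k + \<alpha>) (Field (ordered_prod natLeq (lex_rel V)))"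
proof -
  let ?f = "\<lambda>(k, \<alpha>). Poly_Mapping.single v k + \<alpha>"
  have F: "Field (ordered_prod natLeq (lex_rel V)) = UNIV \<times> {\<alpha>. Poly_Mapping.keys \<alpha> \<subseteq> V}"
    by (simp add: Field_ordered_prod[OF natLeq_Well_order assms(2)] Field_natLeq Field_lex_rel)
  have low: "Poly_Mapping.lookup \<alpha> j = 0" if "Poly_Mapping.keys \<alpha> \<subseteq> V" "j \<le> v" for \<alpha> :: "nat \<Rightarrow>\<^sub>0 nat" and j
    using that assms(1)[of j] by (auto simp: keys_subset_iff)
  have lu: "Poly_Mapping.lookup (Poly_Mapping.single v k + \<alpha>) j = (if j = v then k else Poly_Mapping.lookup \<alpha> j)"
    if "Poly_Mapping.keys \<alpha> \<subseteq> V" for k :: nat and \<alpha> j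
    using low[OF that] by (simp add: lookup_add lookup_single when_def)
  show inj: "inj_on ?f (Field (ordered_prod natLeq (lex_rel V)))"
  proof (rule inj_onI, unfold F, clarify)
    fix k l :: nat and \<alpha> \<beta> assume *: "Poly_Mapping.keys \<alpha> \<subseteq> V" "Poly_Mapping.keys \<beta> \<subseteq> V"
      and eq: "Poly_Mapping.single v k + \<alpha> = Poly_Mapping.single v l + \<beta>"
    have e: "(if j = v then k else Poly_Mapping.lookup \<alpha> j) = (if j = v then l else Poly_Mapping.lookup \<beta> j)" for j
      using lu[OF *(1), of k j] lu[OF *(2), of l j] eq by simp
    have "k = l" using e[of v] by simp
    moreover have "Poly_Mapping.lookup \<alpha> j = Poly_Mapping.lookup \<beta> j" for j
      using e[of j] low[OF *(1), of v] low[OF *(2), of v] by (cases "j = v") auto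
    ultimately show "k = l \<and> \<alpha> = \<beta>" by (auto intro: poly_mapping_eqI)
  qed
  have lex: "lex_less (Poly_Mapping.single v k + \<alpha>) (Poly_Mapping.single v l + \<beta>) \<longleftrightarrow>
      lex_less \<alpha> \<beta> \<or> \<alpha> = \<beta> \<and> k < l" (is "?L \<longleftrightarrow> ?R")
    if *: "Poly_Mapping.keys \<alpha> \<subseteq> V" "Poly_Mapping.keys \<beta> \<subseteq> V" for k l \<alpha> \<beta>
  proof
    assume ?L
    then obtain m where m: "(if m = v then k else Poly_Mapping.lookup \<alpha> m) < (if m = v then l else Poly_Mapping.lookup \<beta> m)"
      and above: "\<And>j. j > m \<Longrightarrow> (if j = v then k else Poly_Mapping.lookup \<alpha> j) = (if j = v then l else Poly_Mapping.lookup \<beta> j)"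
      by (auto simp: lex_less_def lu[OF *(1)] lu[OF *(2)])
    show ?R
    proof (cases "m = v")
      case True
      have "Poly_Mapping.lookup \<alpha> j = Poly_Mapping.lookup \<beta> j" for j
        using above[of j] low[OF *(1), of j] low[OF *(2), of j] True by (cases "j \<le> v") auto
      then have "\<alpha> = \<beta>" by (rule poly_mapping_eqI)
      then show ?thesis using m True by simp
    next
      case False
      then have "Poly_Mapping.lookup \<alpha> m < Poly_Mapping.lookup \<beta> m" using m by simp
      moreover have "Poly_Mapping.lookup \<alpha> j = Poly_Mapping.lookup \<beta> j" if "j > m" for j
        using above[OF that] low[OF *(1), of j] low[OF *(2), of j] by (cases "j = v") auto
      ultimately show ?thesis unfolding lex_less_def by blast
    qed
  next
    assume ?R
    then show ?L
    proof (elim disjE conjE)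
      assume "lex_less \<alpha> \<beta>"
      then obtain m where m: "Poly_Mapping.lookup \<alpha> m < Poly_Mapping.lookup \<beta> m"
        "\<And>j. j > m \<Longrightarrow> Poly_Mapping.lookup \<alpha> j = Poly_Mapping.lookup \<beta> j"
        by (auto simp: lex_less_def)
      have "v < m" using low[OF *(2), of m] m(1) by (cases "m \<le> v") auto
      with m show ?L
        unfolding lex_less_def lu[OF *(1)] lu[OF *(2)] by (intro exI[of _ m]) auto
    next
      assume "\<alpha> = \<beta>" "k < l"
      then show ?L
        unfolding lex_less_def lu[OF *(1)] lu[OF *(2)] by (intro exI[of _ v]) auto
    qed
  qed
  show "lex_rel (insert v V) = dir_image (ordered_prod natLeq (lex_rel V)) ?f"
  proof (rule eq_dir_imageI)
    show "?f ` Field (ordered_prod natLeq (lex_rel V)) = Field (lex_rel (insert v V))"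
      unfolding F Field_lex_rel
    proof (intro equalityI subsetI)
      fix x assume "x \<in> ?f ` (UNIV \<times> {\<alpha>. Poly_Mapping.keys \<alpha> \<subseteq> V})"
      then obtain k \<alpha> where "Poly_Mapping.keys \<alpha> \<subseteq> V" "x = Poly_Mapping.single v k + \<alpha>" by auto
      then show "x \<in> {\<alpha>. Poly_Mapping.keys \<alpha> \<subseteq> insert v V}"
        by (auto simp: keys_subset_iff lookup_add lookup_single when_def)
    next
      fix \<alpha> :: "nat \<Rightarrow>\<^sub>0 nat" assume \<alpha>: "\<alpha> \<in> {\<alpha>. Poly_Mapping.keys \<alpha> \<subseteq> insert v V}"
      let ?\<beta> = "\<alpha> - Poly_Mapping.single v (Poly_Mapping.lookup \<alpha> v)"
      have "Poly_Mapping.keys ?\<beta> \<subseteq> V"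
        using \<alpha> by (auto simp: keys_subset_iff lookup_minus lookup_single when_def)
      moreover have "\<alpha> = Poly_Mapping.single v (Poly_Mapping.lookup \<alpha> v) + ?\<beta>"
        by (rule poly_mapping_eqI) (simp add: lookup_add lookup_minus lookup_single when_def)
      ultimately show "\<alpha> \<in> ?f ` (UNIV \<times> {\<alpha>. Poly_Mapping.keys \<alpha> \<subseteq> V})" by force
    qed
  next
    fix x y assume xy: "x \<in> Field (ordered_prod natLeq (lex_rel V))" "y \<in> Field (ordered_prod natLeq (lex_rel V))"
    obtain k \<alpha> l \<beta> where [simp]: "x = (k, \<alpha>)" "y = (l, \<beta>)" by (cases x, cases y)
    have *: "Poly_Mapping.keys \<alpha> \<subseteq> V" "Poly_Mapping.keys \<beta> \<subseteq> V" using xy by (simp_all add: F)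
    have "Poly_Mapping.keys (?f x) \<subseteq> insert v V" "Poly_Mapping.keys (?f y) \<subseteq> insert v V"
      using * by (auto simp: keys_subset_iff lu)
    moreover have "?f x = ?f y \<longleftrightarrow> k = l \<and> \<alpha> = \<beta>" using inj_on_eq_iff[OF inj xy] by simp
    ultimately have "(?f x, ?f y) \<in> lex_rel (insert v V) \<longleftrightarrow> k = l \<and> \<alpha> = \<beta> \<or> lex_less \<alpha> \<beta> \<or> \<alpha> = \<beta> \<and> k < l"
      using lex[OF *] by (simp add: lex_rel_def)
    moreover have natLeq_iff: "(k, l) \<in> natLeq \<longleftrightarrow> k \<le> l" by (simp add: natLeq_def)
    moreover note lex_less_irrefl[of \<alpha>]
    ultimately show "(x, y) \<in> ordered_prod natLeq (lex_rel V) \<longleftrightarrow> (?f x, ?f y) \<in> lex_rel (insert v V)"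
      using * natLeq_iff by (auto simp: ordered_prod_def Field_lex_rel Field_natLeq lex_rel_iff)
  qed
qed

lemma lex_rel_order_type:
  assumes "finite V"
  shows "Well_order (lex_rel V) \<and> countable (Field (lex_rel V)) \<and> ord_of (lex_rel V) = omega ^ card V"
  using assms
proof (induction rule: finite_linorder_min_induct)
  case empty
  have "lex_rel {} = {(0, 0)}" by (auto simp: lex_rel_def lex_less_def)
  then show ?case by (simp add: Well_order_singleton[simplified] ord_of_singleton Well_order_singleton)
next
  case (insert v V)
  then have wo: "Well_order (lex_rel V)" and cnt: "countable (Field (lex_rel V))"
    and ord: "ord_of (lex_rel V) = omega ^ card V" by auto
  let ?p = "ordered_prod natLeq (lex_rel V)"
  let ?f = "\<lambda>(k, \<alpha>). Poly_Mapping.single v k + \<alpha> :: nat \<Rightarrow>\<^sub>0 nat"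
  have eq: "lex_rel (insert v V) = dir_image ?p ?f" and inj: "inj_on ?f (Field ?p)"
    using lex_rel_insert[of V v] insert.hyps wo by auto
  have wop: "Well_order ?p" by (rule Well_order_ordered_prod[OF natLeq_Well_order wo])
  have cntp: "countable (Field ?p)"
    using cnt by (simp add: Field_ordered_prod[OF natLeq_Well_order wo])
  have "ord_of ?p = omega * omega ^ card V"
    unfolding omega_def ord[unfolded omega_def, symmetric]
    using ord_of_times[OF natLeq_Well_order _ wo cnt] by simp
  moreover have "v \<notin> V" using insert.hyps by blast
  ultimately show ?case
    unfolding eq using Well_order_dir_image[OF wop inj] ord_of_dir_image[OF wop inj cntp] cntp insert.hyps
    by (simp add: dir_image_Field)
qed

text \<open>
  Exponents at places beyond \<open>i - 1\<close> vanish, which turns the bounded comparison in the order on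
  indices into \<open>lex_less\<close>.
\<close>

lemma Omega_rel_iff:
  "((\<beta>, j), (\<alpha>, i)) \<in> Omega_rel n \<longleftrightarrow> (\<beta>, j) \<in> Omega n \<and> (\<alpha>, i) \<in> Omega n \<and>
     (i < j \<or> i = j \<and> (\<beta> = \<alpha> \<or> lex_less \<beta> \<alpha>))"
proof (cases "(\<beta>, j) \<in> Omega n \<and> (\<alpha>, i) \<in> Omega n \<and> i = j")
  case True
  then have "Poly_Mapping.lookup \<beta> k = Poly_Mapping.lookup \<alpha> k" if "\<not> k \<le> i - 1" for k
    using that by (auto simp: Omega_def keys_subset_iff)
  then have "(\<exists>m. Poly_Mapping.lookup \<beta> m < Poly_Mapping.lookup \<alpha> m \<and>
      (\<forall>k. m < k \<and> k \<le> i - 1 \<longrightarrow> Poly_Mapping.lookup \<alpha> k = Poly_Mapping.lookup \<beta> k)) \<longleftrightarrow> lex_less \<beta> \<alpha>"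
    unfolding lex_less_def by metis
  with True show ?thesis by (auto simp: Omega_rel_def idx_greater_def)
next
  case False
  then show ?thesis by (auto simp: Omega_rel_def idx_greater_def)
qed

lemma Field_Omega_rel: "Field (Omega_rel n) = Omega n"
  by (auto simp: Omega_rel_def Field_def)

lemma Omega_Suc: "Omega (Suc n) = (\<lambda>\<alpha>. (\<alpha>, Suc n)) ` {\<alpha>. Poly_Mapping.keys \<alpha> \<subseteq> {1..n}} \<union> Omega n"
  by (auto simp: Omega_def le_Suc_eq)

text \<open>
  The indices with the new derivation \<open>\<partial>\<^sub>n\<^sub>+\<^sub>1\<close> are the smallest ones, so that their block is the
  first summand.
\<close>

lemma Omega_rel_Suc:
  fixes n :: nat
  defines "f \<equiv> case_sum (\<lambda>\<alpha>. (\<alpha>, Suc n)) id"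
  shows "Omega_rel (Suc n) = dir_image (ordered_sum (lex_rel {1..n}) (Omega_rel n)) f"
    and "inj_on f (Field (ordered_sum (lex_rel {1..n}) (Omega_rel n)))"
proof -
  let ?s = "ordered_sum (lex_rel {1..n}) (Omega_rel n)"
  have F: "Field ?s = Inl ` {\<alpha>. Poly_Mapping.keys \<alpha> \<subseteq> {1..n}} \<union> Inr ` Omega n"
    by (simp add: Field_ordered_sum Field_lex_rel Field_Omega_rel)
  have fi: "f (Inl \<alpha>) = (\<alpha>, Suc n)" "f (Inr a) = a" for \<alpha> a by (simp_all add: f_def)
  have le: "i \<le> n" if "(\<alpha>, i) \<in> Omega n" for \<alpha> i using that by (simp add: Omega_def)
  have mem: "(\<alpha>, Suc n) \<in> Omega (Suc n) \<longleftrightarrow> Poly_Mapping.keys \<alpha> \<subseteq> {1..n}"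
    "a \<in> Omega n \<Longrightarrow> a \<in> Omega (Suc n)" for \<alpha> a
    by (auto simp: Omega_def)
  show "inj_on f (Field ?s)"
    by (rule inj_onI) (auto simp: F fi simp del: One_nat_def dest: le)
  show "Omega_rel (Suc n) = dir_image ?s f"
  proof (rule eq_dir_imageI)
    show "f ` Field ?s = Field (Omega_rel (Suc n))"
      unfolding F Field_Omega_rel Omega_Suc by (simp add: image_Un image_image fi)
  next
    fix x y assume "x \<in> Field ?s" "y \<in> Field ?s"
    then show "(x, y) \<in> ?s \<longleftrightarrow> (f x, f y) \<in> Omega_rel (Suc n)"
      by (cases x; cases y)
        (auto simp: F fi Omega_rel_iff mem Field_lex_rel Field_Omega_rel lex_rel_iff simp del: One_nat_def dest: le)
  qed
qed

lemma Omega_rel_order_type: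
  "Well_order (Omega_rel n) \<and> countable (Omega n) \<and> ord_of (Omega_rel n) = omega_poly n"
proof (induction n)
  case 0
  have [simp]: "Omega 0 = {}" "Omega_rel 0 = {}" by (auto simp: Omega_def Omega_rel_def)
  have "dir_image ({} :: nat rel) f = {}" for f :: "nat \<Rightarrow> (nat \<Rightarrow>\<^sub>0 nat) \<times> nat" by (simp add: dir_image_def)
  moreover have wo: "Well_order ({} :: nat rel)" by (rule Well_order_if_least_elements) auto
  ultimately have "ord_of ({} :: ((nat \<Rightarrow>\<^sub>0 nat) \<times> nat) rel) = 0"
    using ord_of_dir_image[OF wo] by (metis Field_empty countable_empty inj_on_empty zero_ordinal_def)
  moreover have "Well_order ({} :: ((nat \<Rightarrow>\<^sub>0 nat) \<times> nat) rel)" by (rule Well_order_if_least_elements) auto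
  ultimately show ?case by simp
next
  case (Suc n)
  let ?s = "ordered_sum (lex_rel {1..n}) (Omega_rel n)"
  note lex = lex_rel_order_type[of "{1..n}", simplified]
  have wo: "Well_order ?s" using lex Suc by (intro Well_order_ordered_sum) auto
  have cnt: "countable (Field ?s)" using lex Suc by (simp add: Field_ordered_sum Field_Omega_rel)
  have "ord_of ?s = omega_poly (Suc n)"
    using lex Suc ord_of_plus[of "lex_rel {1..n}" "Omega_rel n"] by (simp add: Field_Omega_rel)
  then show ?case
    using Well_order_dir_image[OF wo Omega_rel_Suc(2)] ord_of_dir_image[OF wo Omega_rel_Suc(2) cnt] cnt
    by (simp add: Omega_rel_Suc(1)[symmetric] Field_Omega_rel[of "Suc n", symmetric])
      (simp add: Omega_rel_Suc(1) dir_image_Field)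
qed

text \<open>
  The witness is the most significant place where the two vectors differ.
\<close>

lemma lex_less_if_pointwise_le:
  assumes "\<And>k. Poly_Mapping.lookup \<beta> k \<le> Poly_Mapping.lookup \<alpha> k"
  shows "\<beta> = \<alpha> \<or> lex_less \<beta> \<alpha>"
proof (cases "\<beta> = \<alpha>")
  case False
  let ?D = "{k. Poly_Mapping.lookup \<beta> k \<noteq> Poly_Mapping.lookup \<alpha> k}"
  have "?D \<subseteq> Poly_Mapping.keys \<beta> \<union> Poly_Mapping.keys \<alpha>" by (auto simp: in_keys_iff)
  then have fin: "finite ?D" by (rule finite_subset) simp
  have "?D \<noteq> {}" using False poly_mapping_eqI[of \<beta> \<alpha>] by blast
  with fin have "Max ?D \<in> ?D" by (rule Max_in)
  then have "Poly_Mapping.lookup \<beta> (Max ?D) < Poly_Mapping.lookup \<alpha> (Max ?D)"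
    using assms[of "Max ?D"] by simp
  moreover have "Poly_Mapping.lookup \<beta> k = Poly_Mapping.lookup \<alpha> k" if "k > Max ?D" for k
    using Max_ge[OF fin, of k] that by auto
  ultimately show ?thesis unfolding lex_less_def by blast
qed simp

lemma not_lex_less_zero: "\<not> lex_less \<beta> 0"
  by (simp add: lex_less_def)

text \<open>
  The lexicographic order is invariant under translation. The assumption on \<open>\<delta>\<close> excludes the
  truncated subtraction \<open>0 - 1 = 0\<close>, which would break this; where \<open>\<alpha>\<^sub>m = 0\<close>, truncation only
  affects a place below the decisive one.
\<close>

lemma lex_less_shift:
  assumes "lex_less \<delta> \<alpha>" "Poly_Mapping.lookup \<delta> m \<noteq> 0"
  shows "lex_less (\<gamma> + (\<delta> - Poly_Mapping.single m 1)) (\<gamma> + (\<alpha> - Poly_Mapping.single m 1))"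
proof -
  obtain k where k: "Poly_Mapping.lookup \<delta> k < Poly_Mapping.lookup \<alpha> k"
    "\<And>j. j > k \<Longrightarrow> Poly_Mapping.lookup \<delta> j = Poly_Mapping.lookup \<alpha> j"
    using assms(1) by (auto simp: lex_less_def)
  then show ?thesis
    unfolding lex_less_def using assms(2)
    by (intro exI[of _ k]) (auto simp: lookup_add lookup_minus lookup_single when_def)
qed

text \<open>
  The effect of \<open>x\<^sup>\<gamma>\<partial>\<^sub>m\<close> on a monomial: the exponent of \<open>x\<^sub>m\<close> drops, and the factor \<open>x\<^sup>\<gamma>\<close> only
  involves less significant variables.
\<close>

lemma lex_less_lower:
  assumes "Poly_Mapping.lookup \<alpha> m \<noteq> 0" "\<And>k. k \<ge> m \<Longrightarrow> Poly_Mapping.lookup \<gamma> k = 0"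
  shows "lex_less (\<gamma> + (\<alpha> - Poly_Mapping.single m 1)) \<alpha>"
  unfolding lex_less_def using assms
  by (intro exI[of _ m]) (auto simp: lookup_add lookup_minus lookup_single when_def)

lemma Omega_iff:
  "(\<alpha>, i) \<in> Omega n \<longleftrightarrow>
     1 \<le> i \<and> i \<le> n \<and> (\<forall>k. Poly_Mapping.lookup \<alpha> k \<noteq> 0 \<longrightarrow> 1 \<le> k \<and> k < i)"
proof (cases "1 \<le> i")
  case True
  then have "k \<le> i - 1 \<longleftrightarrow> k < i" for k by arith
  then show ?thesis by (simp add: Omega_def subset_iff in_keys_iff)
qed (simp add: Omega_def)

lemma OmegaD:
  assumes "(\<alpha>, i) \<in> Omega n"
  shows "1 \<le> i" "i \<le> n" "k \<ge> i \<Longrightarrow> Poly_Mapping.lookup \<alpha> k = 0"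
    "Poly_Mapping.lookup \<alpha> k \<noteq> 0 \<Longrightarrow> 1 \<le> k \<and> k < i"
  using assms unfolding Omega_iff by (blast, blast, metis not_less, blast)

lemma OmegaI:
  assumes "1 \<le> i" "i \<le> n" "\<And>k. Poly_Mapping.lookup \<alpha> k \<noteq> 0 \<Longrightarrow> 1 \<le> k \<and> k < i"
  shows "(\<alpha>, i) \<in> Omega n"
  using assms unfolding Omega_iff by blast

lemma shift_in_Omega:
  assumes "(\<gamma>, m) \<in> Omega n" "(\<alpha>, i) \<in> Omega n" "m \<le> i"
  shows "(\<gamma> + (\<alpha> - Poly_Mapping.single m 1), i) \<in> Omega n"
proof (rule OmegaI)
  fix k assume "Poly_Mapping.lookup (\<gamma> + (\<alpha> - Poly_Mapping.single m 1)) k \<noteq> 0"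
  then have "Poly_Mapping.lookup \<gamma> k \<noteq> 0 \<or> Poly_Mapping.lookup \<alpha> k \<noteq> 0"
    by (auto simp: lookup_add lookup_minus)
  then show "1 \<le> k \<and> k < i"
    using OmegaD(4)[OF assms(1), of k] OmegaD(4)[OF assms(2), of k] assms(3) by auto
qed (use OmegaD[OF assms(2)] in auto)


section \<open>Brackets of monomial derivations\<close>

text \<open>
  The second-order terms cancel because partial derivatives commute.
\<close>

lemma commutator_der:
  fixes q s :: "'k::comm_ring_1 mpoly"
  assumes "q \<in> poly_ring n" "s \<in> poly_ring n"
  shows "commutator (der n q k) (der n s i) = der n (q * partial k s) i - der n (s * partial i q) k"
proof (rule ext)
  fix p
  show "commutator (der n q k) (der n s i) p = (der n (q * partial k s) i - der n (s * partial i q) k) p"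
    using assms
    by (simp add: commutator_apply der_def poly_ring_mult poly_ring_partial partial_mult
        partial_commute[of i k p] algebra_simps)
qed

lemma der_single: "der n (Poly_Mapping.single \<alpha> c) i = scale_der c (der n (Poly_Mapping.single \<alpha> 1) i)"
  by (rule ext) (simp add: der_def scale_der_def mult_single flip: mult.assoc)

lemma single_in_poly_ring:
  assumes "(\<alpha>, i) \<in> Omega n"
  shows "Poly_Mapping.single \<alpha> c \<in> poly_ring (i - 1)" "Poly_Mapping.single \<alpha> c \<in> poly_ring n"
proof -
  show *: "Poly_Mapping.single \<alpha> c \<in> poly_ring (i - 1)"
    using assms by (intro poly_ring_single) (auto simp: Omega_def)
  show "Poly_Mapping.single \<alpha> c \<in> poly_ring n"
    using subsetD[OF poly_ring_mono *, of n] OmegaD(2)[OF assms] by simp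
qed

lemma commutator_basis_elem:
  assumes "(\<gamma>, m) \<in> Omega n" "(\<alpha>, i) \<in> Omega n"
  shows "commutator (basis_elem n (\<gamma>, m)) (basis_elem n (\<alpha>, i)) =
    scale_der (of_nat (Poly_Mapping.lookup \<alpha> m) :: 'k::field) (basis_elem n (\<gamma> + (\<alpha> - Poly_Mapping.single m 1), i)) -
    scale_der (of_nat (Poly_Mapping.lookup \<gamma> i)) (basis_elem n (\<alpha> + (\<gamma> - Poly_Mapping.single i 1), m))"
  using commutator_der[OF single_in_poly_ring(2)[OF assms(1), of "1::'k"] single_in_poly_ring(2)[OF assms(2), of 1]]
  by (simp add: basis_elem_def partial_single mult_single der_single[of n _ "of_nat _"])

text \<open>
  A derivation is determined by its values on the variables: \<open>\<Sum>\<^sub>i q\<^sub>i\<partial>\<^sub>i\<close> maps \<open>x\<^sub>i\<close> to \<open>q\<^sub>i\<close>.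
  Hence the coefficients of these values are the functionals dual to the monomial basis.
\<close>

definition coefficient :: "(nat \<Rightarrow>\<^sub>0 nat) \<times> nat \<Rightarrow> ('k::field mpoly \<Rightarrow> 'k mpoly) \<Rightarrow> 'k" where
  "coefficient = (\<lambda>(\<alpha>, i) D. Poly_Mapping.lookup (D (Poly_Mapping.single (Poly_Mapping.single i 1) 1)) \<alpha>)"

lemma coefficient_linear:
  fixes D E :: "'k::field mpoly \<Rightarrow> 'k mpoly"
  shows "coefficient a (0 :: 'k mpoly \<Rightarrow> 'k mpoly) = 0"
  and "coefficient a (D + E) = coefficient a D + coefficient a E"
  and "coefficient a (scale_der c D) = c * coefficient a D"
proof -
  have "Poly_Mapping.lookup (Poly_Mapping.single 0 c * p) \<alpha> = c * Poly_Mapping.lookup p \<alpha>" for p :: "'k mpoly" and \<alpha>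
    unfolding mult_map_scale_conv_mult[symmetric] by (simp add: Poly_Mapping.map.rep_eq when_def)
  then show "coefficient a (scale_der c D) = c * coefficient a D"
    by (simp add: coefficient_def scale_der_def split: prod.split)
qed (simp_all add: coefficient_def lookup_add split: prod.split)

lemma coefficient_basis_elem:
  assumes "a \<in> Omega n" "b \<in> Omega n"
  shows "coefficient a (basis_elem n b :: 'k::field mpoly \<Rightarrow> _) = (if a = b then 1 else 0)"
proof -
  obtain \<alpha> i \<beta> j where [simp]: "a = (\<alpha>, i)" "b = (\<beta>, j)" by (cases a, cases b)
  have "Poly_Mapping.single (Poly_Mapping.single i 1) (1 :: 'k) \<in> poly_ring n"
    using OmegaD(1,2)[of \<alpha> i n] assms by (intro poly_ring_single) auto
  then show ?thesis
    by (auto simp: coefficient_def basis_elem_def der_def partial_single mult_single lookup_single when_def)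
qed

lemma basis_elem_in_triangular:
  assumes "a \<in> Omega n"
  shows "(basis_elem n a :: 'k::field mpoly \<Rightarrow> _) \<in> triangular n"
proof -
  obtain \<alpha> i where a: "a = (\<alpha>, i)" by (cases a)
  have i: "i \<in> {1..n}" using OmegaD[of \<alpha> i n] assms a by auto
  show ?thesis
  proof (rule triangularI)
    show "(if j = i then Poly_Mapping.single \<alpha> 1 else 0 :: 'k mpoly) \<in> poly_ring (j - 1)" for j
      using single_in_poly_ring(1)[of \<alpha> i n 1] assms a by auto
    have "(\<Sum>j = 1..n. (if j = i then Poly_Mapping.single \<alpha> 1 else 0) * partial j p) =
        Poly_Mapping.single \<alpha> 1 * partial i p" for p :: "'k mpoly"
    proof -
      have "(\<Sum>j = 1..n. (if j = i then Poly_Mapping.single \<alpha> 1 else 0) * partial j p) =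
          (\<Sum>j = 1..n. if j = i then Poly_Mapping.single \<alpha> 1 * partial i p else 0)"
        by (intro sum.cong) auto
      then show ?thesis using i by simp
    qed
    then show "basis_elem n a p = (if p \<in> poly_ring n then
        \<Sum>j = 1..n. (if j = i then Poly_Mapping.single \<alpha> 1 else 0 :: 'k mpoly) * partial j p else 0)" for p
      by (simp add: a basis_elem_def der_def)
  qed
qed

lemma span_basis_elem:
  "module.span scale_der (basis_elem n ` Omega n) = (triangular n :: ('k::field mpoly \<Rightarrow> 'k mpoly) set)"
proof -
  interpret lie_algebra scale_der "triangular n :: ('k mpoly \<Rightarrow> 'k mpoly) set" commutator
    by (rule lie_algebra_triangular)
  let ?S = "span (basis_elem n ` Omega n)"
  have der: "der n q i \<in> ?S" if "i \<in> {1..n}" "q \<in> poly_ring (i - 1)" for i and q :: "'k mpoly"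
  proof -
    have "der n q i = (\<Sum>m\<in>Poly_Mapping.keys q. scale_der (Poly_Mapping.lookup q m) (basis_elem n (m, i)))"
    proof (rule ext)
      fix p
      have "q * partial i p = (\<Sum>m\<in>Poly_Mapping.keys q.
          Poly_Mapping.single m (Poly_Mapping.lookup q m) * partial i p)"
        by (subst (1) mpoly_eq_sum[of q]) (rule sum_distrib_right)
      then show "der n q i p = (\<Sum>m\<in>Poly_Mapping.keys q.
          scale_der (Poly_Mapping.lookup q m) (basis_elem n (m, i))) p"
        by (simp add: sum_fun_apply basis_elem_def flip: der_single)
          (simp add: der_def)
    qed
    moreover have "(m, i) \<in> Omega n" if "m \<in> Poly_Mapping.keys q" for m
      using that \<open>q \<in> _\<close> \<open>i \<in> _\<close> by (auto simp: Omega_def poly_ring_def)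
    ultimately show ?thesis
      by simp (rule span_sum, rule span_scale, rule span_base, rule imageI, simp)
  qed
  show ?thesis
  proof
    show "?S \<subseteq> triangular n"
      using subspace_L basis_elem_in_triangular by (intro span_minimal) blast+
    show "triangular n \<subseteq> ?S"
      unfolding triangular_def using der by (auto intro!: span_sum)
  qed
qed

text \<open>
  To come down from \<open>x\<^sup>\<alpha>\<partial>\<^sub>i\<close> to \<open>x\<^sup>\<beta>\<partial>\<^sub>j\<close> there are three cases. If \<open>i = j\<close>, let \<open>m\<close> be the most
  significant variable in which \<open>\<alpha>\<close> and \<open>\<beta>\<close> differ and let \<open>\<gamma>\<close> be the part of \<open>\<beta>\<close> below \<open>m\<close>; then
  the bracket with \<open>x\<^sup>\<gamma>\<partial>\<^sub>m\<close> leads to the exponent \<open>\<gamma> + (\<alpha> - e(m))\<close>, where \<open>e(m)\<close> is the exponent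
  vector of \<open>x\<^sub>m\<close>; it is at least \<open>\<beta>\<close> in every variable up to \<open>m\<close> and agrees with it above.
  If \<open>i < j\<close> and \<open>\<alpha> \<noteq> 0\<close>, any \<open>\<partial>\<^sub>m\<close> with \<open>\<alpha>\<^sub>m \<noteq> 0\<close> stays in the
  block of \<open>\<partial>\<^sub>i\<close> and hence above. If \<open>i < j\<close> and \<open>\<alpha> = 0\<close>, the bracket of \<open>x\<^sub>i x\<^sup>\<beta>\<partial>\<^sub>j\<close> with \<open>\<partial>\<^sub>i\<close> is
  \<open>-(\<beta>\<^sub>i + 1) x\<^sup>\<beta>\<partial>\<^sub>j\<close>.
\<close>

lemma triangular_ordered_basis:
  "lie_algebra_ordered_basis scale_der (triangular n :: ('k::field_char_0 mpoly \<Rightarrow> 'k mpoly) set)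
     commutator (Omega_rel n) (basis_elem n)"
proof -
  interpret lie_algebra scale_der "triangular n :: ('k mpoly \<Rightarrow> 'k mpoly) set" commutator
    by (rule lie_algebra_triangular)
  let ?r = "Omega_rel n"
  let ?X = "basis_elem n :: _ \<Rightarrow> 'k mpoly \<Rightarrow> 'k mpoly"
  have mem_span: "scale_der c (?X a) \<in> span (?X ` S)" if "c \<noteq> 0 \<Longrightarrow> a \<in> S" for c a S
    using that by (cases "c = 0") (auto intro: span_scale span_base span_zero)
  have inj: "inj_on ?X (Omega n)"
  proof (rule inj_onI)
    fix a b assume "a \<in> Omega n" "b \<in> Omega n" "?X a = ?X b"
    then show "a = b"
      using coefficient_basis_elem[of a n a, where 'k = 'k] coefficient_basis_elem[of a n b, where 'k = 'k]
      by (auto split: if_splits)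
  qed
  show ?thesis
  proof (unfold_locales, unfold Field_Omega_rel)
    show "well_order_on (Omega n) ?r" using Omega_rel_order_type by (simp add: Field_Omega_rel)
    show "inj_on ?X (Omega n)" by (rule inj)
    show "independent (?X ` Omega n)"
      unfolding dependent_def
    proof clarify
      fix a assume a: "a \<in> Omega n" and *: "?X a \<in> span (?X ` Omega n - {?X a})"
      have "subspace {D. coefficient a D = (0 :: 'k)}"
        by (rule subspaceI) (simp_all add: coefficient_linear)
      moreover have "?X ` Omega n - {?X a} \<subseteq> {D. coefficient a D = 0}"
        using a by (auto simp: coefficient_basis_elem)
      ultimately have "coefficient a (?X a) = 0" using * span_minimal by blast
      then show False using a by (simp add: coefficient_basis_elem)
    qed
    show "span (?X ` Omega n) = triangular n" by (rule span_basis_elem)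
  next
    fix c a assume ca: "c \<in> Omega n" "a \<in> Omega n"
    obtain \<gamma> m \<alpha> i where [simp]: "c = (\<gamma>, m)" "a = (\<alpha>, i)" by (cases c, cases a)
    show "commutator (?X c) (?X a) \<in> span (?X ` under ?r a)"
      unfolding \<open>c = _\<close> \<open>a = _\<close> commutator_basis_elem[OF ca[simplified]]
    proof (intro span_diff mem_span)
      assume "of_nat (Poly_Mapping.lookup \<alpha> m) \<noteq> (0 :: 'k)"
      then have m: "Poly_Mapping.lookup \<alpha> m \<noteq> 0" by auto
      then have "m < i" using OmegaD(4)[of \<alpha> i n m] ca by auto
      then show "(\<gamma> + (\<alpha> - Poly_Mapping.single m 1), i) \<in> under ?r (\<alpha>, i)"
        using ca shift_in_Omega[of \<gamma> m n \<alpha> i] lex_less_lower[OF m, of \<gamma>] OmegaD(3)[of \<gamma> m n]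
        by (auto simp: under_def Omega_rel_iff)
    next
      assume "of_nat (Poly_Mapping.lookup \<gamma> i) \<noteq> (0 :: 'k)"
      then have "Poly_Mapping.lookup \<gamma> i \<noteq> 0" by auto
      then have "i < m" using OmegaD(4)[of \<gamma> m n i] ca by auto
      then show "(\<alpha> + (\<gamma> - Poly_Mapping.single i 1), m) \<in> under ?r (\<alpha>, i)"
        using ca shift_in_Omega[of \<alpha> i n \<gamma> m] by (auto simp: under_def Omega_rel_iff)
    qed
  next
    fix b a assume ba: "(b, a) \<in> ?r" "b \<noteq> a"
    obtain \<beta> j \<alpha> i where [simp]: "b = (\<beta>, j)" "a = (\<alpha>, i)" by (cases b, cases a)
    have \<Omega>: "(\<beta>, j) \<in> Omega n" "(\<alpha>, i) \<in> Omega n" and lt: "i < j \<or> i = j \<and> lex_less \<beta> \<alpha>"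
      using ba by (auto simp: Omega_rel_iff)
    \<comment> \<open>The first two cases, in which \<open>[x\<^sup>\<gamma>\<partial>\<^sub>m, x\<^sup>\<delta>\<partial>\<^sub>l]\<close> with \<open>i \<le> l\<close> has only its first term, as \<open>m < l\<close>.\<close>
    have raise: "\<exists>c\<in>Omega n. \<exists>a' s. (b, a') \<in> ?r \<and> (a', a) \<in> ?r \<and> a' \<noteq> a \<and> s \<noteq> 0 \<and>
        commutator (?X c) (?X a) = scale_der s (?X a') \<and>
        (\<forall>d\<in>underS ?r a. commutator (?X c) (?X d) \<in> span (?X ` underS ?r a'))"
      if m: "Poly_Mapping.lookup \<alpha> m \<noteq> 0" and c: "(\<gamma>, m) \<in> Omega n"
        and le: "i < j \<or> \<beta> = \<gamma> + (\<alpha> - Poly_Mapping.single m 1) \<or> lex_less \<beta> (\<gamma> + (\<alpha> - Poly_Mapping.single m 1))"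
      for \<gamma> m
    proof -
      let ?\<alpha>' = "\<gamma> + (\<alpha> - Poly_Mapping.single m 1)"
      have mi: "m < i" using OmegaD(4)[OF \<Omega>(2) m] by simp
      have \<gamma>0: "Poly_Mapping.lookup \<gamma> k = 0" if "k \<ge> m" for k using OmegaD(3)[OF c that] .
      have less: "lex_less ?\<alpha>' \<alpha>" using lex_less_lower[OF m \<gamma>0] .
      have \<Omega>': "(?\<alpha>', i) \<in> Omega n" using shift_in_Omega[OF c \<Omega>(2)] mi by simp
      have br: "commutator (?X (\<gamma>, m)) (?X (\<delta>, l)) =
          scale_der (of_nat (Poly_Mapping.lookup \<delta> m)) (?X (\<gamma> + (\<delta> - Poly_Mapping.single m 1), l))"
        if "(\<delta>, l) \<in> Omega n" "i \<le> l" for \<delta> l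
        using commutator_basis_elem[OF c that(1), where 'k = 'k] \<gamma>0[of l] mi that(2) by simp
      have "commutator (?X (\<gamma>, m)) (?X d) \<in> span (?X ` underS ?r (?\<alpha>', i))" if d: "d \<in> underS ?r a" for d
      proof -
        obtain \<delta> l where [simp]: "d = (\<delta>, l)" by (cases d)
        have d\<Omega>: "(\<delta>, l) \<in> Omega n" and dlt: "i < l \<or> i = l \<and> lex_less \<delta> \<alpha>"
          using d by (auto simp: underS_def Omega_rel_iff)
        have "(\<gamma> + (\<delta> - Poly_Mapping.single m 1), l) \<in> underS ?r (?\<alpha>', i)"
          if nz: "Poly_Mapping.lookup \<delta> m \<noteq> 0"
        proof -
          have "(\<gamma> + (\<delta> - Poly_Mapping.single m 1), l) \<in> Omega n"
            using shift_in_Omega[OF c d\<Omega>] mi dlt by auto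
          moreover have "lex_less (\<gamma> + (\<delta> - Poly_Mapping.single m 1)) ?\<alpha>'" if "lex_less \<delta> \<alpha>"
            using lex_less_shift[OF that nz] .
          ultimately show ?thesis
            using dlt \<Omega>' by (auto simp: underS_def Omega_rel_iff lex_less_irrefl)
        qed
        then show ?thesis
          using dlt unfolding \<open>d = _\<close> by (subst br[OF d\<Omega>]) (auto intro!: mem_span)
      qed
      moreover have "((\<beta>, j), (?\<alpha>', i)) \<in> ?r" using \<Omega> \<Omega>' le lt by (auto simp: Omega_rel_iff)
      moreover have "((?\<alpha>', i), a) \<in> ?r" "?\<alpha>' \<noteq> \<alpha>"
        using \<Omega> \<Omega>' less by (auto simp: Omega_rel_iff lex_less_irrefl)
      ultimately show ?thesis
        using br[OF \<Omega>(2)] m c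
        by (intro bexI[of _ "(\<gamma>, m)"] exI[of _ "(?\<alpha>', i)"] exI[of _ "of_nat (Poly_Mapping.lookup \<alpha> m)"]) auto
    qed
    show "\<exists>c\<in>Omega n. \<exists>a' s. (b, a') \<in> ?r \<and> (a', a) \<in> ?r \<and> a' \<noteq> a \<and> s \<noteq> 0 \<and>
        commutator (?X c) (?X a) = scale_der s (?X a') \<and>
        (\<forall>d\<in>underS ?r a. commutator (?X c) (?X d) \<in> span (?X ` underS ?r a'))"
    proof (cases "i = j")
      case True
      with lt obtain m where m: "Poly_Mapping.lookup \<beta> m < Poly_Mapping.lookup \<alpha> m"
        "\<And>k. k > m \<Longrightarrow> Poly_Mapping.lookup \<beta> k = Poly_Mapping.lookup \<alpha> k"
        by (auto simp: lex_less_def)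
      then have m0: "Poly_Mapping.lookup \<alpha> m \<noteq> 0" by simp
      define \<gamma> where "\<gamma> = (\<Sum>k<m. Poly_Mapping.single k (Poly_Mapping.lookup \<beta> k))"
      have \<gamma>: "Poly_Mapping.lookup \<gamma> k = (if k < m then Poly_Mapping.lookup \<beta> k else 0)" for k
        by (simp add: \<gamma>_def lookup_sum lookup_single when_def)
      have "(\<gamma>, m) \<in> Omega n"
        using OmegaD(4)[OF \<Omega>(2) m0] OmegaD(2)[OF \<Omega>(2)] OmegaD(4)[OF \<Omega>(1)]
        by (intro OmegaI) (auto simp: \<gamma> split: if_splits)
      moreover have "\<beta> = \<gamma> + (\<alpha> - Poly_Mapping.single m 1) \<or> lex_less \<beta> (\<gamma> + (\<alpha> - Poly_Mapping.single m 1))"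
        using m by (intro lex_less_if_pointwise_le)
          (auto simp: lookup_add lookup_minus lookup_single when_def \<gamma> not_less_iff_gr_or_eq)
      ultimately show ?thesis using raise[OF m0] by blast
    next
      case False
      then have ij: "i < j" using lt by simp
      show ?thesis
      proof (cases "\<alpha> = 0")
        case False
        then obtain m where m: "Poly_Mapping.lookup \<alpha> m \<noteq> 0"
          by (metis lookup_zero poly_mapping_eqI)
        then have "(0, m) \<in> Omega n"
          using OmegaD(4)[OF \<Omega>(2) m] OmegaD(2)[OF \<Omega>(2)] by (intro OmegaI) auto
        then show ?thesis using raise[OF m] ij by blast
      next
        case True
        \<comment> \<open>The exponent of \<open>x\<^sub>i x\<^sup>\<beta>\<close>, which may be multiplied with \<open>\<partial>\<^sub>j\<close> because \<open>i < j\<close>.\<close>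
        let ?\<beta>' = "\<beta> + Poly_Mapping.single i 1"
        have c: "(?\<beta>', j) \<in> Omega n"
          using OmegaD[OF \<Omega>(1)] OmegaD(1)[OF \<Omega>(2)] ij
          by (intro OmegaI) (auto simp: lookup_add lookup_single when_def split: if_splits)
        have eq: "commutator (?X (?\<beta>', j)) (?X a) =
            scale_der (- of_nat (Suc (Poly_Mapping.lookup \<beta> i))) (?X b)"
          using commutator_basis_elem[OF c \<Omega>(2), where 'k = 'k] True
          by (simp add: lookup_add scale_minus_left del: of_nat_Suc)
        have "commutator (?X (?\<beta>', j)) (?X d) \<in> span (?X ` underS ?r b)" if d: "d \<in> underS ?r a" for d
        proof -
          obtain \<delta> l where [simp]: "d = (\<delta>, l)" by (cases d)
          have d\<Omega>: "(\<delta>, l) \<in> Omega n" and il: "i < l"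
            using d True not_lex_less_zero by (auto simp: underS_def Omega_rel_iff)
          show ?thesis
            unfolding \<open>d = _\<close> commutator_basis_elem[OF c d\<Omega>]
          proof (intro span_diff mem_span)
            assume "of_nat (Poly_Mapping.lookup \<delta> j) \<noteq> (0 :: 'k)"
            then have "Poly_Mapping.lookup \<delta> j \<noteq> 0" by auto
            then have "j < l" using OmegaD(4)[OF d\<Omega>] by blast
            then show "(?\<beta>' + (\<delta> - Poly_Mapping.single j 1), l) \<in> underS ?r b"
              using shift_in_Omega[OF c d\<Omega>] \<Omega> by (auto simp: underS_def Omega_rel_iff)
          next
            assume "of_nat (Poly_Mapping.lookup ?\<beta>' l) \<noteq> (0 :: 'k)"
            then have nz: "Poly_Mapping.lookup ?\<beta>' l \<noteq> 0" by (metis of_nat_0)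
            then have "l < j" using OmegaD(4)[OF c] by blast
            moreover have "lex_less (\<delta> + (?\<beta>' - Poly_Mapping.single l 1)) \<beta>"
              unfolding lex_less_def using nz il OmegaD(3)[OF d\<Omega>]
              by (intro exI[of _ l]) (auto simp: lookup_add lookup_minus lookup_single when_def)
            ultimately show "(\<delta> + (?\<beta>' - Poly_Mapping.single l 1), j) \<in> underS ?r b"
              using shift_in_Omega[OF d\<Omega> c] \<Omega> by (auto simp: underS_def Omega_rel_iff lex_less_irrefl)
          qed
        qed
        moreover have "(b, b) \<in> ?r" using \<Omega> by (simp add: Omega_rel_iff)
        moreover have "- of_nat (Suc (Poly_Mapping.lookup \<beta> i)) \<noteq> (0 :: 'k)"
          by (metis neg_equal_0_iff_equal of_nat_eq_0_iff nat.distinct(2))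
        ultimately show ?thesis
          using eq ba c by (intro bexI[of _ "(?\<beta>', j)"] exI[of _ b] exI) auto
      qed
    qed
  qed
qed


section \<open>The ideals of the triangular derivations\<close>

lemma basis_rel_eq_dir_image: "basis_rel n = dir_image (Omega_rel n) (basis_elem n)"
  by (auto simp: basis_rel_def dir_image_def)

lemma ord_elem_basis_elem:
  assumes "a \<in> Omega n"
  shows "ord_elem n (basis_elem n a :: 'k::field_char_0 mpoly \<Rightarrow> _) =
    ord_of (Restr (Omega_rel n) (under (Omega_rel n) a))"
proof -
  let ?r = "Omega_rel n"
  let ?X = "basis_elem n :: _ \<Rightarrow> 'k mpoly \<Rightarrow> 'k mpoly"
  interpret lie_algebra_ordered_basis scale_der "triangular n :: ('k mpoly \<Rightarrow> 'k mpoly) set"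
    commutator ?r ?X by (rule triangular_ordered_basis)
  have cnt: "countable (Field ?r)" using Omega_rel_order_type by (simp add: Field_Omega_rel)
  have under: "under ?r a \<subseteq> Field ?r" by (auto simp: under_def Field_def)
  have "{y \<in> basis n. (y, ?X a) \<in> basis_rel n} = ?X ` under ?r a"
  proof (intro equalityI subsetI)
    fix y assume "y \<in> {y \<in> basis n. (y, ?X a) \<in> basis_rel n}"
    then obtain b c where "y = ?X b" "?X a = ?X c" "(b, c) \<in> ?r"
      by (auto simp: basis_rel_eq_dir_image dir_image_def)
    moreover then have "a = c"
      using assms FieldI2[of b c ?r] by (intro inj_onD[OF inj_X]) (auto simp: Field_Omega_rel)
    ultimately show "y \<in> ?X ` under ?r a" by (simp add: under_def)
  next
    fix y assume "y \<in> ?X ` under ?r a"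
    then obtain b where b: "y = ?X b" "(b, a) \<in> ?r" by (auto simp: under_def)
    then have "b \<in> Omega n" by (auto simp: Omega_rel_def)
    moreover have "(?X b, ?X a) \<in> dir_image ?r ?X"
      using b(2) unfolding dir_image_def by blast
    ultimately show "y \<in> {y \<in> basis n. (y, ?X a) \<in> basis_rel n}"
      using b(1) by (simp add: basis_def basis_rel_eq_dir_image)
  qed
  moreover have "Restr (basis_rel n) (?X ` under ?r a) = dir_image (Restr ?r (under ?r a)) ?X"
    unfolding basis_rel_eq_dir_image by (rule Restr_dir_image[OF inj_X under])
  moreover have "inj_on ?X (Field (Restr ?r (under ?r a)))"
    by (rule inj_on_subset[OF inj_X mono_Field]) auto
  ultimately show ?thesis
    unfolding ord_elem_def
    using ord_of_dir_image[OF Well_order_Restr[OF wo] _ countable_Field_Restr[OF cnt], of ?X] by simp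
qed

text \<open>
  The ideal \<open>I\<^sub>\<lambda>\<close> is defined by order types of segments of the basis; these can be
  computed in the index set, since the indexing is an isomorphism.
\<close>

lemma I_ideal_eq:
  "(I_ideal n l :: ('k::field_char_0 mpoly \<Rightarrow> 'k mpoly) set) = module.span scale_der (basis_elem n `
     {a \<in> Field (Omega_rel n). ord_of (Restr (Omega_rel n) (under (Omega_rel n) a)) \<le> l})"
proof -
  have "{x \<in> basis n. ord_elem n x \<le> l} = (basis_elem n :: _ \<Rightarrow> 'k mpoly \<Rightarrow> 'k mpoly) `
     {a \<in> Omega n. ord_of (Restr (Omega_rel n) (under (Omega_rel n) a)) \<le> l}"
    by (auto simp: basis_def ord_elem_basis_elem)
  then show ?thesis by (simp add: I_ideal_def Field_Omega_rel)
qed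

theorem theorem3p3:
  fixes n :: nat
  assumes "n \<ge> 2"
  shows
    "bij_betw (I_ideal n) {1..ord_of (Omega_rel n)}
       (lie_algebra.nonzero_ideals scale_der
          (triangular n :: ('k::field_char_0 mpoly \<Rightarrow> 'k mpoly) set) commutator) \<and>
     lie_algebra.uniserial scale_der
       (triangular n :: ('k mpoly \<Rightarrow> 'k mpoly) set) commutator \<and>
     lie_algebra.artinian scale_der
       (triangular n :: ('k mpoly \<Rightarrow> 'k mpoly) set) commutator \<and>
     \<not> lie_algebra.noetherian scale_der
       (triangular n :: ('k mpoly \<Rightarrow> 'k mpoly) set) commutator \<and>
     lie_algebra.uniserial_dim scale_der
       (triangular n :: ('k mpoly \<Rightarrow> 'k mpoly) set) commutator = ord_of (Omega_rel n) + 1 \<and>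
     ord_of (Omega_rel n) = omega_poly n"
proof -
  let ?r = "Omega_rel n"
  let ?X = "basis_elem n :: _ \<Rightarrow> 'k mpoly \<Rightarrow> 'k mpoly"
  interpret lie_algebra_ordered_basis scale_der "triangular n :: ('k mpoly \<Rightarrow> 'k mpoly) set"
    commutator ?r ?X by (rule triangular_ordered_basis)
  have cnt: "countable (Field ?r)" using Omega_rel_order_type by (simp add: Field_Omega_rel)
  \<comment> \<open>The indices of \<open>x\<^sub>1\<^sup>k\<partial>\<^sub>n\<close>; for \<open>n = 1\<close> these would not be triangular.\<close>
  define a where "a = (\<lambda>k. (Poly_Mapping.single (1::nat) (k::nat), n))"
  have a_Omega: "a k \<in> Omega n" for k
    using assms by (auto simp: a_def Omega_iff lookup_single when_def)
  have a_less: "(a k, a (Suc k)) \<in> ?r" "a k \<noteq> a (Suc k)" for k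
  proof -
    have "lex_less (Poly_Mapping.single 1 k) (Poly_Mapping.single 1 (Suc k))"
      by (auto simp: lex_less_def lookup_single when_def)
    then show "(a k, a (Suc k)) \<in> ?r" "a k \<noteq> a (Suc k)"
      using a_Omega[of k] a_Omega[of "Suc k"] by (auto simp: a_def Omega_rel_iff lex_less_irrefl)
  qed
  have "inj a" using inj_single[of "1::nat"] by (auto simp: a_def inj_def)
  then have "infinite (Field ?r)"
    using a_Omega infinite_super[of "range a" "Field ?r"] range_inj_infinite[of a]
    by (auto simp: Field_Omega_rel)
  then have dim: "uniserial_dim = ord_of ?r + 1" by (rule uniserial_dim_eq[OF cnt])
  have "inj_on (\<lambda>A. span (?X ` A)) {A. ofilter ?r A \<and> A \<noteq> {}}"
    using inj_on_span_ofilter by (rule inj_on_subset) auto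
  then have "bij_betw (\<lambda>A. span (?X ` A)) {A. ofilter ?r A \<and> A \<noteq> {}} nonzero_ideals"
    by (simp add: bij_betw_def nonzero_ideals_eq)
  from bij_betw_trans[OF bij_betw_ordinals_ofilters[OF wo cnt] this]
  have "bij_betw (I_ideal n) {1..ord_of ?r} nonzero_ideals"
    by (simp add: comp_def flip: I_ideal_eq)
  with dim show ?thesis
    using ideals_uniserial artinian_if_countable[OF cnt]
      not_noetherian_if_ascending[of a, OF a_less] Omega_rel_order_type by blast
qed

end
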